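(* Consider the Boolean clustering problem $\mathbf{P}_{\mathrm{B}}$ in dimension $d$ with $\lambda=Cd^{-1/4}$ for a sufficiently large absolute constant $C>0$. Then: (1) There is an algorithm $\mathcal{A}$ that, given a single sample ($n=1$), satisfies $\mathrm{err}(\mathcal{A},\mathbf{P}_{\mathrm{B}})\le0.01$. (2) For every $\alpha<1/2$ and every algorithm $\mathcal{A}:(\{\pm1\}^d)^n\to\mathcal{M}$ with $\mathrm{err}(\mathcal{A},\mathbf{P}_{\mathrm{B}})\le\alpha$, \[ \mathrm{mem}_n(\mathcal{A},\mathbf{P}_{\mathrm{B}})=\Omega\!\left(\frac{1-8\lambda^2n\log(dn\log|\mathcal{M}|/C_\alpha)}{\lambda^4n\log(dn\log|\mathcal{M}|/C_\alpha)}C_\alpha\right),\qquad C_\alpha:=(1-2\alpha)\log\frac{1-\alpha}{\alpha}. \] In particular, if $n\le c\sqrt d/\log(d\log(|\mathcal{M}|)/C_\alpha)$ for a sufficiently small absolute constant $c>0$ and $|\mathcal{M}|\le\exp(d^{\tilde C})$ for an absolute constant $\tilde C>0$ fixed in advance, then \[ \mathrm{mem}_n(\mathcal{A},\mathbf{P}_{\mathrm{B}})=\Omega\!\left(\frac{1-8\lambda^2n\log(dn/C_\alpha)}{\lambda^4n\log(dn/C_\alpha)}C_\alpha\right), \] and for $\alpha=1/3$ this is $\widetilde\Omega(d/n)$. (3) If $n\le\sqrt d$, there is an algorithm $\mathcal{A}$ with $\mathrm{err}(\mathcal{A},\mathbf{P}_{\mathrm{B}})\le0.01$ and $\mathrm{mem}_n(\mathcal{A},\mathbf{P}_{\mathrm{B}})=O(d/n)$.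 Moreover, for every $n$ there is an algorithm $\mathcal{A}$ with $\mathrm{err}(\mathcal{A},\mathbf{P}_{\mathrm{B}})\le0.01$ and $\mathrm{mem}_n(\mathcal{A},\mathbf{P}_{\mathrm{B}})=O(d^2n\exp(-n/\sqrt d))$; in particular, if $n\gtrsim\sqrt d\log d$ then $\mathrm{mem}_n(\mathcal{A},\mathbf{P}_{\mathrm{B}})\le1/\mathrm{poly}(d)$.
   Context: Boolean clustering problem $\mathbf{P}_{\mathrm{B}}$: $\theta\sim\Psi=\mathcal{U}(\{\pm1\}^d)$ (uniform), $\mathcal{P}_\theta=\mathrm{BSC}_{(1-\lambda)/2}(\theta)$, where for $x\in\{\pm1\}^d$ and $p\in[0,1]$, $\mathrm{BSC}_p(x)$ is the product distribution of $Y\in\{\pm1\}^d$ with $\Pr[Y_i\ne x_i]=p$ independently for each $i$; the null distribution is $\mathcal{P}_0=\mathcal{U}(\{\pm1\}^d)$. An algorithm receives $X_{1:n}\sim\mathcal{P}_\theta^n$ and outputs a classifier $h:\{\pm1\}^d\to\{0,1\}$ from a set $\mathcal{M}$. $\mathrm{err}(h)=\tfrac12\Pr_{X\sim\mathcal{P}_\theta}[h(X)=0]+\tfrac12\Pr_{X\sim\mathcal{P}_0}[h(X)=1]$, $\mathrm{err}(\mathcal{A},\mathbf{P})=\mathbb{E}_{\theta,X_{1:n},h\leftarrow\mathcal{A}(X_{1:n})}[\mathrm{err}(h)]$, $\mathrm{mem}_n(\mathcal{A},\mathbf{P})=I(\mathcal{A}(X_{1:n});X_{1:n}\mid\theta)$.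 $\widetilde\Omega$ hides logarithmic factors; asymptotic notation hides absolute constants. *)

theory Defs
  imports "HOL-Probability.Probability"
begin

definition cube :: "nat \<Rightarrow> (nat \<Rightarrow> int) set" where
  "cube d = PiE {0..<d} (\<lambda>_. {-1, 1})"

definition bsc :: "nat \<Rightarrow> real \<Rightarrow> (nat \<Rightarrow> int) \<Rightarrow> (nat \<Rightarrow> int) pmf" where
  "bsc d p x = Pi_pmf {0..<d} undefined
      (\<lambda>i. map_pmf (\<lambda>b. if b then - x i else x i) (bernoulli_pmf p))"

definition planted :: "nat \<Rightarrow> real \<Rightarrow> (nat \<Rightarrow> int) \<Rightarrow> (nat \<Rightarrow> int) pmf" where
  "planted d lam \<theta> = bsc d ((1 - lam) / 2) \<theta>"

definition null_dist :: "nat \<Rightarrow> (nat \<Rightarrow> int) pmf" where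
  "null_dist d = pmf_of_set (cube d)"

definition prior :: "nat \<Rightarrow> (nat \<Rightarrow> int) pmf" where
  "prior d = pmf_of_set (cube d)"

definition samples :: "nat \<Rightarrow> 'a pmf \<Rightarrow> (nat \<Rightarrow> 'a) pmf" where
  "samples n D = Pi_pmf {0..<n} undefined (\<lambda>_. D)"

definition sample_space :: "nat \<Rightarrow> nat \<Rightarrow> (nat \<Rightarrow> nat \<Rightarrow> int) set" where
  "sample_space d n = PiE {0..<n} (\<lambda>_. cube d)"

type_synonym classifier = "(nat \<Rightarrow> int) \<Rightarrow> bool"   (* True = output 1, False = output 0 *)
type_synonym algorithm = "(nat \<Rightarrow> nat \<Rightarrow> int) \<Rightarrow> classifier pmf"

definition is_algorithm :: "classifier set \<Rightarrow> algorithm \<Rightarrow> bool" where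
  "is_algorithm M A \<longleftrightarrow> finite M \<and> (\<forall>xs. set_pmf (A xs) \<subseteq> M)"

definition err_h :: "nat \<Rightarrow> real \<Rightarrow> (nat \<Rightarrow> int) \<Rightarrow> classifier \<Rightarrow> real" where
  "err_h d lam \<theta> h =
     1/2 * measure_pmf.prob (planted d lam \<theta>) {x. \<not> h x}
   + 1/2 * measure_pmf.prob (null_dist d) {x. h x}"

definition err_alg :: "nat \<Rightarrow> real \<Rightarrow> nat \<Rightarrow> algorithm \<Rightarrow> real" where
  "err_alg d lam n A =
     measure_pmf.expectation (prior d) (\<lambda>\<theta>.
       measure_pmf.expectation (samples n (planted d lam \<theta>)) (\<lambda>xs.
         measure_pmf.expectation (A xs) (\<lambda>h. err_h d lam \<theta> h)))"

text \<open>Mutual information I(A(X);X) for fixed theta (natural logarithm), written out for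
  finite discrete distributions; outputs range over the finite class M.\<close>
definition mi_given :: "nat \<Rightarrow> real \<Rightarrow> nat \<Rightarrow> classifier set \<Rightarrow> algorithm \<Rightarrow> (nat \<Rightarrow> int) \<Rightarrow> real" where
  "mi_given d lam n M A \<theta> =
     (let S = samples n (planted d lam \<theta>);
          q = (\<lambda>h. \<Sum>xs\<in>sample_space d n. pmf S xs * pmf (A xs) h)
      in \<Sum>xs\<in>sample_space d n. \<Sum>h\<in>M.
           pmf S xs * pmf (A xs) h * ln (pmf (A xs) h / q h))"

definition mem :: "nat \<Rightarrow> real \<Rightarrow> nat \<Rightarrow> classifier set \<Rightarrow> algorithm \<Rightarrow> real" where
  "mem d lam n M A = measure_pmf.expectation (prior d) (\<lambda>\<theta>. mi_given d lam n M A \<theta>)"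

definition C_alpha :: "real \<Rightarrow> real" where
  "C_alpha \<alpha> = (1 - 2 * \<alpha>) * ln ((1 - \<alpha>) / \<alpha>)"

end

theory Submission
  imports Defs
begin

text \<open>
  Lower bound. For a classifier \<open>h\<close> put \<open>f\<^sub>h(X) = Pr[A(X) = h]\<close>. Summing the entropy functional
  \<open>E[f ln f] - E[f] ln E[f]\<close> over \<open>h\<close>, applied to \<open>f\<^sub>h\<close> and to its conditional expectations given
  \<open>\<theta>\<close> and given a fresh sample \<open>X'\<close>, yields \<open>I(h;X)\<close>, \<open>I(h;\<theta>)\<close> and \<open>I(h;X')\<close>, and the
  memorization is \<open>I(h;X) - I(h;\<theta>)\<close>. Two strong data processing inequalities
  \<open>I(h;\<theta>) \<le> 16 \<lambda>\<^sup>2 n I(h;X)\<close> and \<open>I(h;X') \<le> 2 \<lambda>\<^sup>2 I(h;\<theta>)\<close> tensorize over coordinates; on one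
  coordinate they follow from Donsker--Varadhan duality and the subgaussianity of
  \<open>E[\<theta>\<^sub>i | X] = tanh(a S\<^sub>i)\<close>, where \<open>S\<^sub>i\<close> is the sum of the \<open>n\<close> observed signs. Finally a small
  error forces \<open>I(h;X') \<ge> C\<^sub>\<alpha> / 4\<close>. These inequalities lose no logarithm, and \<open>L \<ge> 2\<close> whenever
  the claimed bound is positive, because \<open>C\<^sub>\<alpha> \<le> 4 I(h;X')\<close> is at most \<open>4 ln |M|\<close> and at most
  \<open>8 \<lambda>\<^sup>2 d ln 2\<close>.

  Upper bounds. Estimate \<open>\<theta>\<close> coordinatewise by \<open>z\<close> and threshold \<open>\<langle>z, y\<rangle>\<close> (Chebyshev). If \<open>z\<^sub>i\<close> is
  the \<open>i\<close>-th entry of an independently chosen random sample, then \<open>z\<close> is distributed as one fresh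
  sample but carries only \<open>O(1/n)\<close> nats per coordinate; if \<open>z\<^sub>i\<close> is the majority vote, it is
  determined by \<open>\<theta>\<close> up to an exponentially small error.
\<close>

section \<open>Entropy functional and strong data processing\<close>

text \<open>The convention \<open>ln 0 = 0\<close> supplies the usual reading of
  \<open>0 ln 0\<close>. Neither \<open>w\<close> nor \<open>f\<close> is normalized, so the
  functional is positively homogeneous in \<open>f\<close> and applies directly to conditional
  probabilities of a fixed output.\<close>

definition ent :: "'a set \<Rightarrow> ('a \<Rightarrow> real) \<Rightarrow> ('a \<Rightarrow> real) \<Rightarrow> real" where
  "ent A w f = (\<Sum>x\<in>A. w x * (f x * ln (f x))) - (\<Sum>x\<in>A. w x * f x) * ln (\<Sum>x\<in>A. w x * f x)"

text \<open>This is \<open>ln x \<le> x - 1\<close> at \<open>x = b / a\<close>, multiplied by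
  \<open>a\<close>. Choosing \<open>b\<close> as a scaled or exponentially tilted reference turns it
  into the log-sum inequality or into a Donsker--Varadhan bound.\<close>

lemma mult_ln_diff_ge:
  fixes a b :: real
  assumes "0 \<le> a" "0 \<le> b" "b = 0 \<Longrightarrow> a = 0"
  shows "a - b \<le> a * (ln a - ln b)"
proof (cases "a = 0")
  case False
  then have ab: "0 < a" "0 < b" using assms by (auto simp: less_le)
  have "ln (b / a) \<le> b / a - 1" using ab by (intro ln_le_minus_one) auto
  then have "a * ln (b / a) \<le> a * (b / a - 1)" using ab by (intro mult_left_mono) auto
  then show ?thesis using ab by (simp add: ln_div algebra_simps)
qed (use assms in auto)

text \<open>The pointwise bound is applied to \<open>f x\<close> against \<open>c * g x\<close>.
  With \<open>c = F / G\<close> the linear remainder \<open>F - c * G\<close> vanishes after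
  summation.\<close>

lemma log_sum_inequality:
  fixes w f g :: "'a \<Rightarrow> real"
  assumes fin: "finite A" and w: "\<And>x. x \<in> A \<Longrightarrow> 0 \<le> w x"
    and f: "\<And>x. x \<in> A \<Longrightarrow> 0 \<le> f x" and g: "\<And>x. x \<in> A \<Longrightarrow> 0 \<le> g x"
    and fg: "\<And>x. x \<in> A \<Longrightarrow> g x = 0 \<Longrightarrow> f x = 0"
  defines "F \<equiv> \<Sum>x\<in>A. w x * f x" and "G \<equiv> \<Sum>x\<in>A. w x * g x"
  shows "F * (ln F - ln G) \<le> (\<Sum>x\<in>A. w x * (f x * (ln (f x) - ln (g x))))"
proof (cases "F = 0")
  case True
  then have "\<And>x. x \<in> A \<Longrightarrow> w x * f x = 0"
    unfolding F_def using fin w f by (subst (asm) sum_nonneg_eq_0_iff) auto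
  then have "(\<Sum>x\<in>A. w x * (f x * (ln (f x) - ln (g x)))) = 0"
    by (intro sum.neutral) auto
  then show ?thesis using True by simp
next
  case False
  have "0 \<le> F" unfolding F_def using w f by (intro sum_nonneg) auto
  then have F: "0 < F" using False by simp
  have G0: "0 \<le> G" unfolding G_def using w g by (intro sum_nonneg) auto
  have G: "0 < G"
  proof (rule ccontr)
    assume "\<not> 0 < G"
    then have "G = 0" using G0 by simp
    then have "\<And>x. x \<in> A \<Longrightarrow> w x * g x = 0"
      unfolding G_def using fin w g by (subst (asm) sum_nonneg_eq_0_iff) auto
    then have "\<And>x. x \<in> A \<Longrightarrow> w x * f x = 0" using fg by auto
    then have "F = 0" unfolding F_def by (rule sum.neutral[rule_format])
    then show False using False by simp
  qed
  define c where "c = F / G"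
  have c: "0 < c" using F G by (simp add: c_def)
  have pw: "w x * (f x - c * g x + f x * ln c) \<le> w x * (f x * (ln (f x) - ln (g x)))"
    if x: "x \<in> A" for x
  proof (rule mult_left_mono[OF _ w[OF x]])
    have "f x - c * g x \<le> f x * (ln (f x) - ln (c * g x))"
      using f[OF x] g[OF x] fg[OF x] c by (intro mult_ln_diff_ge) auto
    also have "\<dots> = f x * (ln (f x) - ln (g x)) - f x * ln c"
      using c g[OF x] fg[OF x] by (cases "g x = 0") (auto simp: ln_mult algebra_simps)
    finally show "f x - c * g x + f x * ln c \<le> f x * (ln (f x) - ln (g x))" by simp
  qed
  have "(\<Sum>x\<in>A. w x * (f x - c * g x + f x * ln c)) = F - c * G + F * ln c"
    unfolding F_def G_def by (simp add: algebra_simps sum.distrib sum_subtractf sum_distrib_left sum_distrib_right)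
  also have "\<dots> = F * (ln F - ln G)" using F G by (simp add: c_def ln_div)
  finally show ?thesis using pw by (metis (no_types, lifting) sum_mono)
qed

lemma ent_nonneg:
  assumes "finite A" "\<And>x. x \<in> A \<Longrightarrow> 0 \<le> w x" "\<And>x. x \<in> A \<Longrightarrow> 0 \<le> f x" "(\<Sum>x\<in>A. w x) = 1"
  shows "0 \<le> ent A w f"
  using log_sum_inequality[of A w f "\<lambda>_. 1"] assms by (simp add: ent_def)

text \<open>Convexity in the function argument: the gap between the two sides is a sum over
  \<open>k\<close> of log-sum inequalities comparing \<open>f k\<close> with the mixture
  \<open>F\<close>.\<close>

lemma ent_mixture_le:
  assumes finA: "finite A" and finI: "finite I" and w: "\<And>x. x \<in> A \<Longrightarrow> 0 \<le> w x"
    and r: "\<And>k. k \<in> I \<Longrightarrow> 0 \<le> r k" and f: "\<And>k x. k \<in> I \<Longrightarrow> x \<in> A \<Longrightarrow> 0 \<le> f k x"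
  shows "ent A w (\<lambda>x. \<Sum>k\<in>I. r k * f k x) \<le> (\<Sum>k\<in>I. r k * ent A w (f k))"
proof -
  define F where "F x = (\<Sum>k\<in>I. r k * f k x)" for x
  define m where "m k = (\<Sum>x\<in>A. w x * f k x)" for k
  define mF where "mF = (\<Sum>x\<in>A. w x * F x)"
  have mF: "mF = (\<Sum>k\<in>I. r k * m k)"
    unfolding mF_def F_def m_def sum_distrib_left
    by (subst sum.swap) (simp add: mult.left_commute)
  have key: "r k * (m k * (ln (m k) - ln mF)) \<le> r k * (\<Sum>x\<in>A. w x * (f k x * (ln (f k x) - ln (F x))))"
    if k: "k \<in> I" for k
  proof (cases "r k = 0")
    case False
    then have rk: "0 < r k" using r[OF k] by simp
    have F0: "f k x = 0" if x: "x \<in> A" and "F x = 0" for x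
    proof -
      have "r k * f k x = 0"
        using that finI k r f unfolding F_def by (subst (asm) sum_nonneg_eq_0_iff) auto
      then show ?thesis using rk by simp
    qed
    have "m k * (ln (m k) - ln mF) \<le> (\<Sum>x\<in>A. w x * (f k x * (ln (f k x) - ln (F x))))"
      unfolding m_def mF_def
      by (rule log_sum_inequality) (use finA w f k F0 r in \<open>auto simp: F_def intro!: sum_nonneg\<close>)
    then show ?thesis using rk by (intro mult_left_mono) auto
  qed simp
  have "(\<Sum>k\<in>I. r k * (\<Sum>x\<in>A. w x * (f k x * (ln (f k x) - ln (F x)))))
      = (\<Sum>k\<in>I. r k * (\<Sum>x\<in>A. w x * (f k x * ln (f k x)))) - (\<Sum>k\<in>I. \<Sum>x\<in>A. r k * f k x * (w x * ln (F x)))"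
    by (simp add: algebra_simps sum_subtractf sum_distrib_left)
  also have "(\<Sum>k\<in>I. \<Sum>x\<in>A. r k * f k x * (w x * ln (F x))) = (\<Sum>x\<in>A. w x * (F x * ln (F x)))"
    by (subst sum.swap) (simp add: F_def sum_distrib_left sum_distrib_right algebra_simps)
  finally have R: "(\<Sum>k\<in>I. r k * (\<Sum>x\<in>A. w x * (f k x * (ln (f k x) - ln (F x)))))
      = (\<Sum>k\<in>I. r k * (\<Sum>x\<in>A. w x * (f k x * ln (f k x)))) - (\<Sum>x\<in>A. w x * (F x * ln (F x)))" .
  have L: "(\<Sum>k\<in>I. r k * (m k * (ln (m k) - ln mF))) = (\<Sum>k\<in>I. r k * (m k * ln (m k))) - mF * ln mF"
    by (simp add: mF algebra_simps sum_subtractf sum_distrib_left sum_distrib_right)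
  have "(\<Sum>k\<in>I. r k * ent A w (f k))
     = (\<Sum>k\<in>I. r k * (\<Sum>x\<in>A. w x * (f k x * ln (f k x)))) - (\<Sum>k\<in>I. r k * (m k * ln (m k)))"
    by (simp add: ent_def m_def algebra_simps sum_subtractf)
  moreover have "ent A w F = (\<Sum>x\<in>A. w x * (F x * ln (F x))) - mF * ln mF"
    by (simp add: ent_def mF_def)
  moreover have "(\<Sum>k\<in>I. r k * (m k * (ln (m k) - ln mF)))
      \<le> (\<Sum>k\<in>I. r k * (\<Sum>x\<in>A. w x * (f k x * (ln (f k x) - ln (F x)))))"
    by (rule sum_mono) (rule key)
  ultimately have "ent A w F \<le> (\<Sum>k\<in>I. r k * ent A w (f k))" using R L by linarith
  then show ?thesis by (simp add: F_def[abs_def])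
qed

text \<open>The terms in the inner averages over \<open>y\<close> occur once with each sign and
  telescope.\<close>

lemma ent_chain_rule:
  "ent (A \<times> B) (\<lambda>(x, y). w x * v y) f
    = (\<Sum>x\<in>A. w x * ent B v (\<lambda>y. f (x, y))) + ent A w (\<lambda>x. \<Sum>y\<in>B. v y * f (x, y))"
proof -
  have *: "(\<Sum>p\<in>A \<times> B. (case p of (x, y) \<Rightarrow> w x * v y) * h p) = (\<Sum>x\<in>A. w x * (\<Sum>y\<in>B. v y * h (x, y)))"
    for h :: "_ \<Rightarrow> real"
    by (simp add: sum.cartesian_product[symmetric] case_prod_unfold sum_distrib_left mult.assoc)
       (simp add: sum.cartesian_product case_prod_unfold)
  show ?thesis unfolding ent_def * by (simp add: algebra_simps sum_subtractf)
qed

text \<open>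
  The channel is given backwards: \<open>p\<close> is the law of the output \<open>y\<close> and \<open>R y x\<close> the conditional
  probability of the input \<open>x\<close>, so that \<open>f\<close> plays the role of a density with respect to the input
  law \<open>\<Sum>\<^sub>y p y * R y x\<close>, and \<open>\<Sum>\<^sub>x R y x * f x\<close> that of the induced output density.
\<close>

definition sdpi :: "'a set \<Rightarrow> 'b set \<Rightarrow> ('b \<Rightarrow> real) \<Rightarrow> ('b \<Rightarrow> 'a \<Rightarrow> real) \<Rightarrow> real \<Rightarrow> bool" where
  "sdpi A B p R \<eta> \<longleftrightarrow> (\<forall>f. (\<forall>x\<in>A. 0 \<le> f x) \<longrightarrow>
     ent B p (\<lambda>y. \<Sum>x\<in>A. R y x * f x) \<le> \<eta> * ent A (\<lambda>x. \<Sum>y\<in>B. p y * R y x) f)"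

text \<open>Tensorization. The chain rule splits the output entropy into a part in \<open>y'\<close>
  for fixed \<open>y\<close> and a part in \<open>y\<close>. The second channel contracts the
  former, after which convexity removes the mixing over \<open>x\<close>; the first channel
  contracts the latter. The chain rule for the inputs reassembles the bounds with the same
  constant.\<close>

lemma sdpi_product:
  assumes fin: "finite A" "finite B" "finite A'" "finite B'"
    and s: "sdpi A B p R \<eta>" and s': "sdpi A' B' p' R' \<eta>" and "0 \<le> \<eta>"
    and p: "\<And>y. y \<in> B \<Longrightarrow> 0 \<le> p y" and p': "\<And>y. y \<in> B' \<Longrightarrow> 0 \<le> p' y"
    and R: "\<And>y x. y \<in> B \<Longrightarrow> x \<in> A \<Longrightarrow> 0 \<le> R y x"
    and R': "\<And>y x. y \<in> B' \<Longrightarrow> x \<in> A' \<Longrightarrow> 0 \<le> R' y x"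
  shows "sdpi (A \<times> A') (B \<times> B') (\<lambda>(y, y'). p y * p' y') (\<lambda>(y, y') (x, x'). R y x * R' y' x') \<eta>"
  unfolding sdpi_def
proof (intro allI impI)
  fix f :: "'a \<times> 'c \<Rightarrow> real" assume f: "\<forall>x\<in>A \<times> A'. 0 \<le> f x"
  define q where "q x = (\<Sum>y\<in>B. p y * R y x)" for x
  define q' where "q' x = (\<Sum>y\<in>B'. p' y * R' y x)" for x
  \<comment> \<open>A half-transformed density: the first coordinate is already an output, the
    second is still an input.\<close>
  define g where "g y x' = (\<Sum>x\<in>A. R y x * f (x, x'))" for y x'
  define G where "G = (\<lambda>(y, y'). \<Sum>x'\<in>A'. R' y' x' * g y x')"
  have G_eq: "(\<lambda>y. \<Sum>x\<in>A \<times> A'. (case y of (y, y') \<Rightarrow> \<lambda>(x, x'). R y x * R' y' x') x * f x) = G"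
  proof
    fix y :: "'b \<times> 'd"
    obtain u v where y: "y = (u, v)" by (cases y)
    have "(\<Sum>x\<in>A \<times> A'. (case y of (y, y') \<Rightarrow> \<lambda>(x, x'). R y x * R' y' x') x * f x)
       = (\<Sum>x\<in>A. \<Sum>x'\<in>A'. R u x * R' v x' * f (x, x'))"
      unfolding y by (simp add: sum.cartesian_product case_prod_unfold)
    also have "\<dots> = G y"
      unfolding y G_def g_def
      by (subst sum.swap) (simp add: sum_distrib_left algebra_simps)
    finally show "(\<Sum>x\<in>A \<times> A'. (case y of (y, y') \<Rightarrow> \<lambda>(x, x'). R y x * R' y' x') x * f x) = G y" .
  qed
  have w_eq: "(\<lambda>x. \<Sum>y\<in>B \<times> B'. (case y of (y, y') \<Rightarrow> p y * p' y') * (case y of (y, y') \<Rightarrow> \<lambda>(x, x'). R y x * R' y' x') x)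
     = (\<lambda>(x, x'). q x * q' x')"
    by (rule ext)
       (auto simp: q_def q'_def sum_product sum.cartesian_product case_prod_unfold algebra_simps intro!: sum.cong)
  have g0: "0 \<le> g y x'" if "y \<in> B" "x' \<in> A'" for y x'
    unfolding g_def using R f that by (intro sum_nonneg) auto
  have q'0: "0 \<le> q' x" if "x \<in> A'" for x unfolding q'_def using p' R' that by (intro sum_nonneg) auto
  have 1: "p y * ent B' p' (\<lambda>y'. G (y, y')) \<le> p y * (\<eta> * (\<Sum>x\<in>A. R y x * ent A' q' (\<lambda>x'. f (x, x'))))"
    if y: "y \<in> B" for y
  proof (rule mult_left_mono[OF _ p[OF y]])
    have "ent B' p' (\<lambda>y'. G (y, y')) \<le> \<eta> * ent A' q' (g y)"
      using s'[unfolded sdpi_def, rule_format, of "g y"] g0[OF y] by (simp add: G_def q'_def[abs_def])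
    also have "ent A' q' (g y) \<le> (\<Sum>x\<in>A. R y x * ent A' q' (\<lambda>x'. f (x, x')))"
      unfolding g_def[abs_def] using fin q'0 R f y by (intro ent_mixture_le) auto
    finally show "ent B' p' (\<lambda>y'. G (y, y')) \<le> \<eta> * (\<Sum>x\<in>A. R y x * ent A' q' (\<lambda>x'. f (x, x')))"
      using \<open>0 \<le> \<eta>\<close> by (simp add: mult_left_mono)
  qed
  \<comment> \<open>Averaging the backward kernel \<open>R y\<close> over \<open>p\<close> restores
    the input law \<open>q\<close>.\<close>
  have 2: "(\<Sum>y\<in>B. p y * (\<eta> * (\<Sum>x\<in>A. R y x * ent A' q' (\<lambda>x'. f (x, x')))))
     = \<eta> * (\<Sum>x\<in>A. q x * ent A' q' (\<lambda>x'. f (x, x')))"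
    unfolding q_def sum_distrib_left sum_distrib_right
    by (subst sum.swap) (simp add: algebra_simps)
  have 3: "(\<Sum>y'\<in>B'. p' y' * G (y, y')) = (\<Sum>x\<in>A. R y x * (\<Sum>x'\<in>A'. q' x' * f (x, x')))" for y
  proof -
    have "(\<Sum>y'\<in>B'. p' y' * G (y, y')) = (\<Sum>x'\<in>A'. q' x' * g y x')"
      unfolding G_def q'_def prod.case sum_distrib_left sum_distrib_right
      by (subst sum.swap) (simp add: algebra_simps)
    also have "\<dots> = (\<Sum>x\<in>A. R y x * (\<Sum>x'\<in>A'. q' x' * f (x, x')))"
      unfolding g_def sum_distrib_left by (subst sum.swap) (simp add: algebra_simps)
    finally show ?thesis .
  qed
  have 4: "ent B p (\<lambda>y. \<Sum>y'\<in>B'. p' y' * G (y, y')) \<le> \<eta> * ent A q (\<lambda>x. \<Sum>x'\<in>A'. q' x' * f (x, x'))"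
    unfolding 3 using s[unfolded sdpi_def, rule_format, of "\<lambda>x. \<Sum>x'\<in>A'. q' x' * f (x, x')"] q'0 f
    by (simp add: q_def[abs_def] sum_nonneg)
  show "ent (B \<times> B') (\<lambda>(y, y'). p y * p' y') (\<lambda>y. \<Sum>x\<in>A \<times> A'. (case y of (y, y') \<Rightarrow> \<lambda>(x, x'). R y x * R' y' x') x * f x)
    \<le> \<eta> * ent (A \<times> A') (\<lambda>x. \<Sum>y\<in>B \<times> B'. (case y of (y, y') \<Rightarrow> p y * p' y') * (case y of (y, y') \<Rightarrow> \<lambda>(x, x'). R y x * R' y' x') x) f"
    unfolding G_eq w_eq ent_chain_rule distrib_left 2[symmetric]
    by (intro add_mono sum_mono 1 4)
qed

lemma ent_reindex:
  assumes "bij_betw \<phi> A1 A2" "\<And>x. x \<in> A1 \<Longrightarrow> w2 (\<phi> x) = w1 x" "\<And>x. x \<in> A1 \<Longrightarrow> f2 (\<phi> x) = f1 x"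
  shows "ent A2 w2 f2 = ent A1 w1 f1"
  unfolding ent_def sum.reindex_bij_betw[OF assms(1), symmetric] using assms(2,3) by simp

lemma sdpi_reindex:
  assumes \<phi>: "bij_betw \<phi> A1 A2" and \<psi>: "bij_betw \<psi> B1 B2"
    and p: "\<And>y. y \<in> B1 \<Longrightarrow> p2 (\<psi> y) = p1 y"
    and R: "\<And>y x. y \<in> B1 \<Longrightarrow> x \<in> A1 \<Longrightarrow> R2 (\<psi> y) (\<phi> x) = R1 y x"
    and s: "sdpi A1 B1 p1 R1 \<eta>"
  shows "sdpi A2 B2 p2 R2 \<eta>"
  unfolding sdpi_def
proof (intro allI impI)
  fix f :: "_ \<Rightarrow> real" assume f: "\<forall>x\<in>A2. 0 \<le> f x"
  have "ent B2 p2 (\<lambda>y. \<Sum>x\<in>A2. R2 y x * f x) = ent B1 p1 (\<lambda>y. \<Sum>x\<in>A1. R1 y x * f (\<phi> x))"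
    by (rule ent_reindex[OF \<psi>]) (simp_all add: p R sum.reindex_bij_betw[OF \<phi>, symmetric])
  also have "\<dots> \<le> \<eta> * ent A1 (\<lambda>x. \<Sum>y\<in>B1. p1 y * R1 y x) (\<lambda>x. f (\<phi> x))"
    using s[unfolded sdpi_def, rule_format, of "\<lambda>x. f (\<phi> x)"] f bij_betwE[OF \<phi>] by simp
  also have "ent A1 (\<lambda>x. \<Sum>y\<in>B1. p1 y * R1 y x) (\<lambda>x. f (\<phi> x)) = ent A2 (\<lambda>x. \<Sum>y\<in>B2. p2 y * R2 y x) f"
    by (rule ent_reindex[OF \<phi>, symmetric]) (simp_all add: p R sum.reindex_bij_betw[OF \<psi>, symmetric])
  finally show "ent B2 p2 (\<lambda>y. \<Sum>x\<in>A2. R2 y x * f x) \<le> \<eta> * ent A2 (\<lambda>x. \<Sum>y\<in>B2. p2 y * R2 y x) f" .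
qed

lemma bij_betw_PiE_Suc:
  "bij_betw (\<lambda>(x, a). x(d := a)) (PiE {0..<d} (\<lambda>_. A) \<times> A) (PiE {0..<Suc d} (\<lambda>_. A))"
proof -
  have ins: "{0..<Suc d} = insert d {0..<d}" by auto
  show ?thesis
    unfolding bij_betw_def
  proof
    show "inj_on (\<lambda>(x, a). x(d := a)) (PiE {0..<d} (\<lambda>_. A) \<times> A)"
    proof (rule inj_onI, clarsimp)
      fix x a y b
      assume x: "x \<in> {0..<d} \<rightarrow>\<^sub>E A" and y: "y \<in> {0..<d} \<rightarrow>\<^sub>E A" and eq: "x(d := a) = y(d := b)"
      have "x i = y i" for i using fun_cong[OF eq, of i] x y by (cases "i = d") (auto simp: PiE_def extensional_def)
      then show "x = y \<and> a = b" using fun_cong[OF eq, of d] by auto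
    qed
    show "(\<lambda>(x, a). x(d := a)) ` (PiE {0..<d} (\<lambda>_. A) \<times> A) = PiE {0..<Suc d} (\<lambda>_. A)"
      unfolding ins PiE_insert_eq by (auto simp: image_iff)
  qed
qed

lemma sdpi_power:
  fixes d :: nat
  assumes fin: "finite A" "finite B" and s: "sdpi A B p R \<eta>" and "0 \<le> \<eta>"
    and p: "\<And>y. y \<in> B \<Longrightarrow> 0 \<le> p y" and R: "\<And>y x. y \<in> B \<Longrightarrow> x \<in> A \<Longrightarrow> 0 \<le> R y x"
  shows "sdpi (PiE {0..<d} (\<lambda>_. A)) (PiE {0..<d} (\<lambda>_. B))
    (\<lambda>y. \<Prod>i<d. p (y i)) (\<lambda>y x. \<Prod>i<d. R (y i) (x i)) \<eta>"
proof (induction d)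
  case 0
  show ?case by (simp add: sdpi_def ent_def)
next
  case (Suc d)
  have prod: "sdpi (PiE {0..<d} (\<lambda>_. A) \<times> A) (PiE {0..<d} (\<lambda>_. B) \<times> B)
    (\<lambda>(y, y'). (\<Prod>i<d. p (y i)) * p y') (\<lambda>(y, y') (x, x'). (\<Prod>i<d. R (y i) (x i)) * R y' x') \<eta>"
    by (intro sdpi_product Suc s \<open>0 \<le> \<eta>\<close> finite_PiE)
       (auto intro!: fin p R prod_nonneg simp: PiE_iff)
  show ?case
    by (rule sdpi_reindex[OF bij_betw_PiE_Suc bij_betw_PiE_Suc _ _ prod]) auto
qed

section \<open>One-coordinate channels\<close>

lemma tanh_le_self:
  fixes x :: real assumes "0 \<le> x" shows "tanh x \<le> x"
proof -
  have "(\<lambda>x. x - tanh x) 0 \<le> (\<lambda>x. x - tanh x) x"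
  proof (rule DERIV_nonneg_imp_nondecreasing[OF assms])
    fix y :: real
    have "((\<lambda>x. x - tanh x) has_real_derivative 1 - (1 - tanh y ^ 2)) (at y)"
      by (auto intro!: derivative_eq_intros)
    then show "\<exists>D. ((\<lambda>x. x - tanh x) has_real_derivative D) (at y) \<and> 0 \<le> D"
      by (intro exI[of _ "tanh y ^ 2"]) auto
  qed
  then show ?thesis by simp
qed

lemma abs_tanh_le: "\<bar>tanh x\<bar> \<le> \<bar>x\<bar>" for x :: real
  using tanh_le_self[of "\<bar>x\<bar>"] by (auto simp: abs_if split: if_splits)

text \<open>The logarithm of \<open>cosh\<close> has derivative \<open>tanh\<close>, which is at
  most the identity on the nonnegative axis; evenness covers the rest.\<close>

lemma cosh_le_exp_half_square: "cosh x \<le> exp (x\<^sup>2 / 2)" for x :: real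
proof -
  have pos: "ln (cosh x) \<le> x\<^sup>2 / 2" if x: "0 \<le> x" for x :: real
  proof -
    have "(\<lambda>x. x\<^sup>2 / 2 - ln (cosh x)) 0 \<le> (\<lambda>x. x\<^sup>2 / 2 - ln (cosh x)) x"
    proof (rule DERIV_nonneg_imp_nondecreasing[OF x])
      fix y :: real assume y: "0 \<le> y" "y \<le> x"
      have "((\<lambda>x. x\<^sup>2 / 2 - ln (cosh x)) has_real_derivative y - tanh y) (at y)"
        by (auto intro!: derivative_eq_intros simp: tanh_def)
      then show "\<exists>D. ((\<lambda>x. x\<^sup>2 / 2 - ln (cosh x)) has_real_derivative D) (at y) \<and> 0 \<le> D"
        using tanh_le_self[OF y(1)] by auto
    qed
    then show ?thesis by simp
  qed
  have "ln (cosh x) \<le> x\<^sup>2 / 2"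
    using pos[of "\<bar>x\<bar>"] by simp
  then show ?thesis by (metis cosh_real_pos exp_le_cancel_iff exp_ln)
qed

text \<open>Here \<open>g x\<close> is the posterior mean of a uniform sign given \<open>x\<close>,
  and \<open>\<delta>\<close> is the integral of \<open>f * g\<close> under \<open>P\<close>. The
  output entropy is at most the chi-square quantity \<open>\<delta>\<^sup>2 / m\<close>, while
  duality with the linear test function \<open>t * g\<close> bounds the input entropy below by
  \<open>\<delta>\<^sup>2 / (2 * v * m)\<close>.\<close>

lemma sdpi_binary_subgaussian:
  fixes R :: "int \<Rightarrow> 'a \<Rightarrow> real"
  assumes fin: "finite A" and R: "\<And>y x. y \<in> {-1, 1} \<Longrightarrow> x \<in> A \<Longrightarrow> 0 \<le> R y x" and \<sigma>: "0 < v"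
  defines "P \<equiv> \<lambda>x. (R 1 x + R (-1) x) / 2"
  assumes g: "\<And>x. x \<in> A \<Longrightarrow> P x * g x = (R 1 x - R (-1) x) / 2"
    and sg: "\<And>t. (\<Sum>x\<in>A. P x * exp (t * g x)) \<le> exp (v * t\<^sup>2 / 2)"
  shows "sdpi A {-1, 1} (\<lambda>_. 1/2) R (2 * v)"
  unfolding sdpi_def
proof (intro allI impI)
  fix f :: "'a \<Rightarrow> real" assume f: "\<forall>x\<in>A. 0 \<le> f x"
  define T where "T y = (\<Sum>x\<in>A. R y x * f x)" for y
  define m where "m = (T 1 + T (-1)) / 2"
  define \<delta> where "\<delta> = (T 1 - T (-1)) / 2"
  have P0: "0 \<le> P x" if "x \<in> A" for x using R[of 1 x] R[of "-1" x] that by (simp add: P_def)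
  have m: "m = (\<Sum>x\<in>A. P x * f x)"
    by (simp add: m_def T_def P_def sum.distrib[symmetric] sum_divide_distrib algebra_simps)
  have \<delta>: "\<delta> = (\<Sum>x\<in>A. f x * (P x * g x))"
    by (simp add: \<delta>_def T_def g sum_subtractf[symmetric] sum_divide_distrib algebra_simps)
  have T0: "0 \<le> T y" if "y \<in> {-1, 1}" for y unfolding T_def using R f that by (intro sum_nonneg) auto
  have m0: "0 \<le> m" using T0[of 1] T0[of "-1"] by (simp add: m_def)
  have entT: "ent {-1, 1} (\<lambda>_. 1/2) T = (T 1 * ln (T 1) + T (-1) * ln (T (-1))) / 2 - m * ln m"
    by (simp add: ent_def m_def add_divide_distrib add.commute)
  have w_eq: "(\<lambda>x. \<Sum>y\<in>{-1, 1::int}. 1/2 * R y x) = P" by (auto simp: P_def add_divide_distrib)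
  have "ent {-1, 1} (\<lambda>_. 1/2) T \<le> 2 * v * ent A P f"
  proof (cases "m = 0")
    case True
    then have "\<And>x. x \<in> A \<Longrightarrow> P x * f x = 0"
      using f P0 fin by (subst (asm) m, subst (asm) sum_nonneg_eq_0_iff) auto
    then have "(\<Sum>x\<in>A. P x * (f x * ln (f x))) = 0" by (intro sum.neutral) auto
    moreover have "T 1 = 0" "T (-1) = 0" using True T0[of 1] T0[of "-1"] by (auto simp: m_def)
    ultimately show ?thesis using True entT m by (simp add: ent_def)
  next
    case False
    then have mp: "0 < m" using m0 by simp
    \<comment> \<open>Linearizing \<open>ln\<close> at the mean \<open>m\<close> produces the
      chi-square bound for the two values \<open>m + \<delta>\<close> and
      \<open>m - \<delta>\<close>.\<close>
    have tln: "u * ln u \<le> u * ln m + u * (u / m - 1)" if "0 \<le> u" for u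
    proof (cases "u = 0")
      case False
      then have "ln (u / m) \<le> u / m - 1" using that mp by (intro ln_le_minus_one) auto
      then have "u * (ln u - ln m) \<le> u * (u / m - 1)"
        using that False mp by (intro mult_left_mono) (auto simp: ln_div)
      then show ?thesis by (simp add: algebra_simps)
    qed simp
    have T1: "T 1 = m + \<delta>" "T (-1) = m - \<delta>" by (auto simp: m_def \<delta>_def field_simps)
    have "ent {-1, 1} (\<lambda>_. 1/2) T \<le>
       ((m + \<delta>) * ln m + (m + \<delta>) * ((m + \<delta>) / m - 1) + ((m - \<delta>) * ln m + (m - \<delta>) * ((m - \<delta>) / m - 1))) / 2 - m * ln m"
      using tln[OF T0[of 1]] tln[OF T0[of "-1"]] unfolding entT T1 by simp
    also have "\<dots> = \<delta>\<^sup>2 / m" using mp by (simp add: field_simps power2_eq_square)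
    finally have upper: "ent {-1, 1} (\<lambda>_. 1/2) T \<le> \<delta>\<^sup>2 / m" .
    \<comment> \<open>This \<open>t\<close> maximizes
      \<open>t * \<delta> - m * v * t\<^sup>2 / 2\<close>. The constant \<open>c\<close> dominates
      the logarithm of the moment generating function, so the tilted function
      \<open>m * exp (t * g x - c)\<close> has mean at most \<open>m\<close>.\<close>
    define t where "t = \<delta> / (m * v)"
    define c where "c = v * t\<^sup>2 / 2"
    have pw: "P x * (f x - m * exp (t * g x - c)) \<le> P x * (f x * (ln (f x) - ln m - t * g x + c))" if x: "x \<in> A" for x
    proof (rule mult_left_mono[OF _ P0[OF x]])
      have "f x - m * exp (t * g x - c) \<le> f x * (ln (f x) - ln (m * exp (t * g x - c)))"
        using f x mp by (intro mult_ln_diff_ge) auto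
      then show "f x - m * exp (t * g x - c) \<le> f x * (ln (f x) - ln m - t * g x + c)"
        using mp by (simp add: ln_mult algebra_simps)
    qed
    have "(\<Sum>x\<in>A. P x * exp (t * g x)) * exp (- c) \<le> exp c * exp (-c)"
      using sg[of t] unfolding c_def by (intro mult_right_mono) auto
    then have e: "(\<Sum>x\<in>A. P x * exp (t * g x)) * exp (- c) \<le> 1" by (simp add: exp_minus)
    have "m - m * ((\<Sum>x\<in>A. P x * exp (t * g x)) * exp (- c)) = (\<Sum>x\<in>A. P x * (f x - m * exp (t * g x - c)))"
    proof -
      have "(\<Sum>x\<in>A. P x * (f x - m * exp (t * g x - c)))
        = (\<Sum>x\<in>A. P x * f x) - (\<Sum>x\<in>A. m * (P x * exp (t * g x) * exp (- c)))"
        unfolding sum_subtractf[symmetric] by (intro sum.cong) (auto simp: algebra_simps exp_diff exp_minus divide_inverse)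
      then show ?thesis by (simp add: m[symmetric] sum_distrib_left sum_distrib_right)
    qed
    also have "\<dots> \<le> (\<Sum>x\<in>A. P x * (f x * (ln (f x) - ln m - t * g x + c)))"
      by (rule sum_mono) (rule pw)
    also have "\<dots> = (\<Sum>x\<in>A. P x * (f x * ln (f x))) - (\<Sum>x\<in>A. P x * f x) * ln m
        - t * (\<Sum>x\<in>A. f x * (P x * g x)) + c * (\<Sum>x\<in>A. P x * f x)"
      by (simp add: sum_distrib_left sum_distrib_right sum_subtractf[symmetric] sum.distrib[symmetric] algebra_simps)
    also have "\<dots> = ent A P f - t * \<delta> + c * m"
      by (simp add: ent_def m[symmetric] \<delta>[symmetric])
    finally have "0 \<le> ent A P f - t * \<delta> + c * m" using e mp
      by (smt (verit) mult_left_le)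
    moreover have "t * \<delta> - c * m = \<delta>\<^sup>2 / m / (2 * v)"
      using mp \<sigma> by (simp add: t_def c_def field_simps power2_eq_square)
    ultimately have "\<delta>\<^sup>2 / m / (2 * v) \<le> ent A P f" by simp
    then have "\<delta>\<^sup>2 / m \<le> 2 * v * ent A P f" using \<sigma> mp by (simp add: field_simps)
    then show ?thesis using upper by simp
  qed
  then show "ent {-1, 1} (\<lambda>_. 1/2) (\<lambda>y. \<Sum>x\<in>A. R y x * f x)
     \<le> 2 * v * ent A (\<lambda>x. \<Sum>y\<in>{-1, 1::int}. 1/2 * R y x) f"
    unfolding w_eq T_def[abs_def] .
qed

text \<open>Transition probability of the binary symmetric channel with flip probability (1 -
  lam)/2. Parametrizing by the correlation makes it symmetric in \<open>s\<close> and
  \<open>v\<close> and includes the uniform law as \<open>lam = 0\<close>.\<close>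

definition bw :: "real \<Rightarrow> int \<Rightarrow> int \<Rightarrow> real" where
  "bw lam s v = (1 + lam * real_of_int (s * v)) / 2"

lemma bw_nonneg: "0 \<le> lam \<Longrightarrow> lam \<le> 1 \<Longrightarrow> s \<in> {-1, 1} \<Longrightarrow> v \<in> {-1, 1} \<Longrightarrow> 0 \<le> bw lam s v"
  by (auto simp: bw_def)

lemma sum_bw: "s \<in> {-1, 1} \<Longrightarrow> (\<Sum>v\<in>{-1, 1}. bw lam s v) = 1"
  by (auto simp: bw_def field_simps)

lemma bw_commute: "bw lam s v = bw lam v s"
  by (simp add: bw_def mult.commute)

text \<open>The posterior mean is \<open>lam * x\<close>, whose moment generating function under a
  uniform sign is \<open>cosh (t * lam)\<close>; hence the variance proxy is lam^2.\<close>

lemma sdpi_bsc: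
  assumes "0 < lam" "lam \<le> 1"
  shows "sdpi {-1, 1} {-1, 1} (\<lambda>_. 1/2) (bw lam) (2 * lam\<^sup>2)"
proof (rule sdpi_binary_subgaussian[where g = "\<lambda>x. lam * real_of_int x"])
  fix t :: real
  have "(\<Sum>x\<in>{-1, 1}. (bw lam 1 x + bw lam (-1) x) / 2 * exp (t * (lam * real_of_int x))) = cosh (t * lam)"
    by (simp add: bw_def cosh_field_def field_simps)
  also have "\<dots> \<le> exp (lam\<^sup>2 * t\<^sup>2 / 2)"
    using cosh_le_exp_half_square[of "t * lam"] by (simp add: power_mult_distrib mult.commute)
  finally show "(\<Sum>x\<in>{-1, 1}. (bw lam 1 x + bw lam (-1) x) / 2 * exp (t * (lam * real_of_int x))) \<le> exp (lam\<^sup>2 * t\<^sup>2 / 2)" .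
qed (use assms in \<open>auto simp: bw_def field_simps\<close>)

section \<open>The channel between one coordinate of \<theta> and its column of observed
  signs\<close>

abbreviation signs :: "nat \<Rightarrow> (nat \<Rightarrow> int) set" where
  "signs n \<equiv> PiE {0..<n} (\<lambda>_. {-1, 1})"

definition colw :: "real \<Rightarrow> nat \<Rightarrow> int \<Rightarrow> (nat \<Rightarrow> int) \<Rightarrow> real" where
  "colw lam n s x = (\<Prod>j<n. bw lam s (x j))"

lemma sum_PiE_prod:
  fixes F :: "nat \<Rightarrow> 'a \<Rightarrow> real"
  assumes "finite B"
  shows "(\<Sum>x\<in>PiE {0..<n} (\<lambda>_. B). \<Prod>j<n. F j (x j)) = (\<Prod>j<n. \<Sum>v\<in>B. F j v)"
  using prod_sum_PiE[of "{0..<n}" "\<lambda>_. B" F] assms by (simp add: atLeast0LessThan)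

text \<open>The moment generating function of the sign sum, used both for the subgaussianity of the
  posterior mean and for the Chernoff bound on the majority vote.\<close>

lemma sum_colw_exp:
  assumes s: "s \<in> {-1, 1}"
  shows "(\<Sum>x\<in>signs n. colw lam n s x * exp (u * real_of_int (\<Sum>j<n. x j)))
    = (cosh u + real_of_int s * (lam * sinh u)) ^ n"
proof -
  have "(\<Sum>x\<in>signs n. colw lam n s x * exp (u * real_of_int (\<Sum>j<n. x j)))
     = (\<Sum>x\<in>signs n. \<Prod>j<n. bw lam s (x j) * exp (u * real_of_int (x j)))"
    by (simp add: colw_def prod.distrib exp_sum[symmetric] sum_distrib_left)
  also have "\<dots> = (\<Prod>j<n. \<Sum>v\<in>{-1, 1}. bw lam s v * exp (u * real_of_int v))"
    by (rule sum_PiE_prod) simp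
  also have "(\<Sum>v\<in>{-1, 1}. bw lam s v * exp (u * real_of_int v)) = cosh u + real_of_int s * (lam * sinh u)"
    using s by (auto simp: bw_def cosh_field_def sinh_field_def field_simps)
  finally show ?thesis by simp
qed

lemma sum_signs_negate:
  "(\<Sum>x\<in>signs n. F x) = (\<Sum>x\<in>signs n. F (\<lambda>j\<in>{0..<n}. - x j))" for F :: "_ \<Rightarrow> real"
proof -
  have inv: "(\<lambda>j\<in>{0..<n}. - (\<lambda>j\<in>{0..<n}. - x j) j) = x" if "x \<in> signs n" for x :: "nat \<Rightarrow> int"
    using that by (auto simp: PiE_iff fun_eq_iff extensional_def)
  show ?thesis
    by (rule sum.reindex_bij_witness[of _ "\<lambda>x. \<lambda>j\<in>{0..<n}. - x j" "\<lambda>x. \<lambda>j\<in>{0..<n}. - x j"])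
       (use inv in \<open>auto simp: PiE_iff\<close>)
qed

text \<open>The posterior mean is \<open>tanh (a * S x)\<close>. Its law is symmetric, so its moment
  generating function is an average of \<open>cosh\<close>, which only grows when
  \<open>tanh\<close> is replaced by the identity. The generating function of \<open>S\<close> is
  explicit, and \<open>n * lam\<^sup>2 \<le> 1\<close> absorbs the contribution of its
  drift.\<close>

lemma sdpi_columns:
  assumes lam: "0 < lam" "lam \<le> 1/2" and n: "1 \<le> n" "real n * lam\<^sup>2 \<le> 1"
  shows "sdpi (signs n) {-1, 1} (\<lambda>_. 1/2) (colw lam n) (16 * (lam\<^sup>2 * real n))"
proof -
  \<comment> \<open>Half the log-likelihood ratio contributed by one observed sign.\<close>
  define a where "a = ln ((1 + lam) / (1 - lam)) / 2"
  define S where "S x = real_of_int (\<Sum>j<n. x j)" for x :: "nat \<Rightarrow> int"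
  define P where "P x = (colw lam n 1 x + colw lam n (-1) x) / 2" for x
  define g where "g x = tanh (a * S x)" for x
  have a0: "0 < a" using lam by (simp add: a_def)
  have "ln ((1 + lam) / (1 - lam)) \<le> (1 + lam) / (1 - lam) - 1" using lam by (intro ln_le_minus_one) auto
  also have "\<dots> \<le> 4 * lam" using lam by (simp add: field_simps)
  finally have a: "a \<le> 2 * lam" by (simp add: a_def)
  have pos: "0 < colw lam n s x" if "s \<in> {-1, 1}" "x \<in> signs n" for s x
    unfolding colw_def
  proof (rule prod_pos)
    fix j assume "j \<in> {..<n}"
    then have "x j \<in> {-1, 1}" using that(2) by (auto simp: PiE_iff)
    then show "0 < bw lam s (x j)" using that(1) lam by (auto simp: bw_def)
  qed
  have ratio: "colw lam n 1 x = exp (2 * (a * S x)) * colw lam n (-1) x" if x: "x \<in> signs n" for x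
  proof -
    have "exp (2 * a * real_of_int (x j)) * bw lam (-1) (x j) = bw lam 1 (x j)" if "j < n" for j
    proof -
      have "exp (2 * a) = (1 + lam) / (1 - lam)" using lam by (simp add: a_def)
      moreover have "x j \<in> {-1, 1}" using x that by (auto simp: PiE_iff)
      ultimately show ?thesis using lam by (auto simp: bw_def exp_minus field_simps)
    qed
    then have "colw lam n 1 x = (\<Prod>j<n. exp (2 * a * real_of_int (x j)) * bw lam (-1) (x j))"
      unfolding colw_def by (intro prod.cong) auto
    also have "\<dots> = exp (2 * (a * S x)) * colw lam n (-1) x"
      by (simp add: colw_def prod.distrib exp_sum[symmetric] S_def sum_distrib_left algebra_simps)
    finally show ?thesis .
  qed
  have Pg: "P x * g x = (colw lam n 1 x - colw lam n (-1) x) / 2" if x: "x \<in> signs n" for x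
  proof -
    define e where "e = exp (2 * (a * S x))"
    have "0 < e" by (simp add: e_def)
    have "g x = (1 - exp (- (2 * (a * S x)))) / (1 + exp (- (2 * (a * S x))))"
      unfolding g_def by (subst tanh_real_altdef) (simp add: mult.assoc)
    also have "\<dots> = (e - 1) / (e + 1)"
      using \<open>0 < e\<close> unfolding exp_minus e_def[symmetric] by (simp add: divide_simps)
    finally have "g x = (e - 1) / (e + 1)" .
    then have "(e + 1) * g x = e - 1" using \<open>0 < e\<close> by simp
    then have "(e + 1) * g x * colw lam n (-1) x = (e - 1) * colw lam n (-1) x" by simp
    then show ?thesis using ratio[OF x] unfolding P_def e_def[symmetric] by (simp add: algebra_simps add_divide_distrib)
  qed
  have sym: "P (\<lambda>j\<in>{0..<n}. - x j) = P x" "g (\<lambda>j\<in>{0..<n}. - x j) = - g x" if "x \<in> signs n" for x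
  proof -
    have "colw lam n s (\<lambda>j\<in>{0..<n}. - x j) = colw lam n (- s) x" for s
      unfolding colw_def by (intro prod.cong) (auto simp: bw_def)
    then show "P (\<lambda>j\<in>{0..<n}. - x j) = P x" by (simp add: P_def add.commute)
    have "S (\<lambda>j\<in>{0..<n}. - x j) = - S x" by (simp add: S_def sum_negf)
    then show "g (\<lambda>j\<in>{0..<n}. - x j) = - g x" by (simp add: g_def)
  qed
  have P0: "0 \<le> P x" if "x \<in> signs n" for x using pos[of 1 x] pos[of "-1" x] that by (simp add: P_def)
  have sg: "(\<Sum>x\<in>signs n. P x * exp (t * g x)) \<le> exp (8 * (lam\<^sup>2 * real n) * t\<^sup>2 / 2)" for t
  proof -
    define u where "u = t * a"
    define \<tau> where "\<tau> = tanh u"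
    have ch: "0 < cosh u" by simp
    have sh: "sinh u = cosh u * \<tau>" by (simp add: \<tau>_def tanh_def)
    have \<tau>: "\<tau>\<^sup>2 \<le> u\<^sup>2" using abs_tanh_le[of u] by (simp add: \<tau>_def abs_le_square_iff)
    have \<tau>1: "\<bar>\<tau>\<bar> < 1" unfolding \<tau>_def using tanh_real_bounds[of u] by (auto simp: abs_if)
    have lt: "\<bar>lam * \<tau>\<bar> \<le> 1" using lam \<tau>1 by (simp add: abs_mult mult_le_one)
    have b: "(cosh u * (1 + r)) ^ n \<le> cosh u ^ n * exp (real n * r)" if "\<bar>r\<bar> \<le> 1" for r :: real
    proof -
      have "(1 + r) ^ n \<le> exp r ^ n" using that by (intro power_mono) auto
      then show ?thesis using ch by (simp add: power_mult_distrib exp_of_nat_mult)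
    qed
    \<comment> \<open>Negating every sign preserves \<open>P\<close> and flips \<open>g\<close>,
      which permits replacing \<open>exp\<close> by \<open>cosh\<close>.\<close>
    have "(\<Sum>x\<in>signs n. P x * exp (t * g x)) = (\<Sum>x\<in>signs n. P x * exp (- t * g x))"
      by (subst sum_signs_negate) (simp add: sym)
    then have "(\<Sum>x\<in>signs n. P x * exp (t * g x)) = (\<Sum>x\<in>signs n. P x * cosh (t * g x))"
      by (simp add: cosh_field_def distrib_left add_divide_distrib sum.distrib sum_divide_distrib[symmetric])
    also have "\<dots> \<le> (\<Sum>x\<in>signs n. P x * cosh (u * S x))"
    proof (intro sum_mono mult_left_mono P0)
      fix x
      have "\<bar>t * g x\<bar> \<le> \<bar>u * S x\<bar>"
        using abs_tanh_le[of "a * S x"] by (simp add: g_def u_def abs_mult mult.assoc mult_left_mono)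
      then have "cosh \<bar>t * g x\<bar> \<le> cosh \<bar>u * S x\<bar>" by (subst cosh_real_nonneg_le_iff) auto
      then show "cosh (t * g x) \<le> cosh (u * S x)" by simp
    qed
    also have "\<dots> = ((\<Sum>x\<in>signs n. colw lam n 1 x * exp (u * S x)) + (\<Sum>x\<in>signs n. colw lam n (-1) x * exp (u * S x))
        + (\<Sum>x\<in>signs n. colw lam n 1 x * exp (- u * S x)) + (\<Sum>x\<in>signs n. colw lam n (-1) x * exp (- u * S x))) / 4"
      by (simp add: P_def cosh_field_def sum.distrib[symmetric] sum_divide_distrib field_simps)
    also have "\<dots> = ((cosh u * (1 + lam * \<tau>)) ^ n + (cosh u * (1 + - (lam * \<tau>))) ^ n) / 2"
      unfolding S_def by (subst (1 2 3 4) sum_colw_exp) (simp_all add: sh algebra_simps)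
    also have "\<dots> \<le> (cosh u ^ n * exp (real n * (lam * \<tau>)) + cosh u ^ n * exp (real n * (- (lam * \<tau>)))) / 2"
      using b[of "lam * \<tau>"] b[of "- (lam * \<tau>)"] lt by simp
    also have "\<dots> = cosh u ^ n * cosh (real n * (lam * \<tau>))" by (simp add: cosh_field_def field_simps)
    also have "\<dots> \<le> exp (u\<^sup>2 / 2) ^ n * exp ((real n * (lam * \<tau>))\<^sup>2 / 2)"
      by (intro mult_mono power_mono cosh_le_exp_half_square) auto
    also have "\<dots> = exp (real n * u\<^sup>2 / 2 + (real n * (lam * \<tau>))\<^sup>2 / 2)"
      by (simp add: exp_of_nat_mult[symmetric] exp_add)
    \<comment> \<open>The fluctuation and drift terms each contribute at most
      \<open>n * u\<^sup>2 / 2\<close>; the assumption on \<open>n * lam\<^sup>2\<close> is what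
      bounds the drift term.\<close>
    also have "\<dots> \<le> exp (real n * u\<^sup>2)"
    proof -
      have "(real n * (lam * \<tau>))\<^sup>2 = real n * (real n * lam\<^sup>2) * \<tau>\<^sup>2" by (simp add: power_mult_distrib power2_eq_square)
      also have "\<dots> \<le> real n * 1 * u\<^sup>2" using n \<tau> by (intro mult_mono) auto
      finally show ?thesis by simp
    qed
    also have "\<dots> \<le> exp (8 * (lam\<^sup>2 * real n) * t\<^sup>2 / 2)"
    proof -
      have "a\<^sup>2 \<le> (2 * lam)\<^sup>2" using a a0 by (intro power_mono) auto
      then have "real n * (t\<^sup>2 * a\<^sup>2) \<le> real n * (t\<^sup>2 * (4 * lam\<^sup>2))" by (intro mult_left_mono) (auto simp: power_mult_distrib)
      then show ?thesis by (simp add: u_def power_mult_distrib algebra_simps)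
    qed
    finally show ?thesis .
  qed
  have "sdpi (signs n) {-1, 1} (\<lambda>_. 1/2) (colw lam n) (2 * (8 * (lam\<^sup>2 * real n)))"
  proof (rule sdpi_binary_subgaussian[where g = g])
    show "finite (signs n)" by (intro finite_PiE) auto
    show "0 < 8 * (lam\<^sup>2 * real n)" using lam n by simp
    show "0 \<le> colw lam n y x" if "y \<in> {-1, 1}" "x \<in> signs n" for y x using pos[OF that] by simp
  qed (use Pg sg in \<open>auto simp: P_def\<close>)
  then show ?thesis by simp
qed

section \<open>Error forces information\<close>

text \<open>The average of the conditional entropies given \<open>y\<close> is the total entropy
  minus the part explained by \<open>y\<close>. With \<open>y\<close> as \<theta> and
  \<open>x\<close> as the samples this yields I(h;X) - I(h;\<theta>).\<close>

lemma ent_compensation: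
  "(\<Sum>y\<in>B. p y * ent A (R y) f)
    = ent A (\<lambda>x. \<Sum>y\<in>B. p y * R y x) f - ent B p (\<lambda>y. \<Sum>x\<in>A. R y x * f x)"
proof -
  have *: "(\<Sum>x\<in>A. (\<Sum>y\<in>B. p y * R y x) * F x) = (\<Sum>y\<in>B. p y * (\<Sum>x\<in>A. R y x * F x))" for F :: "_ \<Rightarrow> real"
    unfolding sum_distrib_left sum_distrib_right by (subst sum.swap) (simp add: mult.assoc)
  show ?thesis unfolding ent_def * by (simp add: algebra_simps sum_subtractf)
qed

lemma ent_alt:
  "ent Y u f = (\<Sum>y\<in>Y. u y * (f y * (ln (f y) - ln (\<Sum>y\<in>Y. u y * f y))))"
  by (simp add: ent_def algebra_simps sum_subtractf sum_distrib_left sum_distrib_right)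

lemma sinh_ge_self: "x \<le> sinh x" if "0 \<le> x" for x :: real
proof -
  have "(\<lambda>x. sinh x - x) 0 \<le> (\<lambda>x. sinh x - x) x"
  proof (rule DERIV_nonneg_imp_nondecreasing[OF that])
    fix y :: real
    have "((\<lambda>x. sinh x - x) has_real_derivative cosh y - 1) (at y)"
      by (auto intro!: derivative_eq_intros)
    then show "\<exists>D. ((\<lambda>x. sinh x - x) has_real_derivative D) (at y) \<and> 0 \<le> D"
      using cosh_real_ge_1[of y] by auto
  qed
  then show ?thesis by simp
qed

text \<open>
  In the next two lemmas \<open>p\<close> and \<open>s\<close> are the probabilities of \<open>h y\<close> under the joint law and under the
  product of its marginals; the dual test function is \<open>t\<close> where \<open>h y\<close> holds and \<open>- t\<close> elsewhere.
\<close>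

lemma C_alpha_le_dual_value:
  fixes \<alpha> p s :: real
  assumes \<alpha>: "0 < \<alpha>" "\<alpha> < 1/2" and p: "p \<le> 1" and ps: "1 - 2 * \<alpha> + s \<le> p"
  defines "t \<equiv> ln ((1 - \<alpha>) / \<alpha>) / 2"
  shows "C_alpha \<alpha> / 4 \<le> t * (2 * p - 1) + 1 - s * exp t - (1 - s) * exp (- t)"
proof -
  define E where "E = exp t"
  have "1 < (1 - \<alpha>) / \<alpha>" using \<alpha> by (simp add: field_simps)
  then have t: "0 < t" unfolding t_def by simp
  then have E1: "1 < E" by (simp add: E_def)
  \<comment> \<open>Since E^2 is the odds ratio, \<alpha> = 1/(E^2 + 1), and the claim becomes an
    inequality in \<open>E\<close> and \<open>t\<close> alone.\<close>
  have "E\<^sup>2 = exp (ln ((1 - \<alpha>) / \<alpha>))" by (simp add: E_def t_def power2_eq_square exp_add[symmetric])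
  also have "\<dots> = (1 - \<alpha>) / \<alpha>" using \<alpha> by simp
  finally have "\<alpha> * (E\<^sup>2 + 1) = 1" using \<alpha> by (simp add: field_simps)
  moreover have "E\<^sup>2 + 1 \<noteq> 0" using E1 by (auto simp: add_nonneg_eq_0_iff)
  ultimately have E2: "\<alpha> = 1 / (E\<^sup>2 + 1)" by (simp add: eq_divide_eq)
  have em: "exp (- t) = 1 / E" by (simp add: E_def exp_minus divide_inverse)
  have sh: "2 * t \<le> E - 1 / E" using sinh_ge_self[of t] t unfolding sinh_field_def em E_def[symmetric] by simp
  have s: "s \<le> 2 * \<alpha>" using p ps by simp
  \<comment> \<open>After \<open>p\<close> is replaced by its lower bound, the coefficient of
    \<open>s\<close> is nonpositive because \<open>sinh t \<ge> t\<close>. The worst case is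
    therefore s = 2\<alpha>.\<close>
  have "t * (2 * (1 - 2 * \<alpha> + s) - 1) \<le> t * (2 * p - 1)" using ps t by (intro mult_left_mono) auto
  moreover have "s * (E - 1 / E - 2 * t) \<le> 2 * \<alpha> * (E - 1 / E - 2 * t)" using s sh by (intro mult_right_mono) auto
  ultimately have 1: "t + 1 - 1 / E - 2 * \<alpha> * (E - 1 / E) \<le> t * (2 * p - 1) + 1 - s * E - (1 - s) * (1 / E)"
    by (simp add: algebra_simps diff_divide_distrib)
  have tE: "E - 1 \<le> t * E"
  proof -
    have "1 - t \<le> exp (- t)" using exp_ge_add_one_self[of "- t"] by simp
    then show ?thesis using E1 unfolding em by (simp add: field_simps)
  qed
  have "1 * (E - 1) \<le> E\<^sup>2 * (t * E)" using tE E1 by (intro mult_mono) (auto simp: one_le_power)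
  moreover have "0 \<le> (E - 1) ^ 3" using E1 by simp
  \<comment> \<open>The term in \<open>t * E\<close> pays for three halves of \<open>E - 1\<close>,
    and the term in \<open>t * E ^ 3\<close> for the remaining half.\<close>
  ultimately have key: "0 \<le> (t / 2) * E ^ 3 + (3 / 2) * (t * E) + (E - 1) ^ 3 - 2 * (E - 1)"
    using tE by (simp add: power2_eq_square power3_eq_cube algebra_simps)
  have "(t + 1 - 1 / E - 2 * \<alpha> * (E - 1 / E)) - t / 2 * (1 - 2 * \<alpha>)
      = ((t / 2) * E ^ 3 + (3 / 2) * (t * E) + (E - 1) ^ 3 - 2 * (E - 1)) / (E * (E\<^sup>2 + 1))"
  proof -
    have nz: "E \<noteq> 0" "E\<^sup>2 + 1 \<noteq> 0" using E1 by (auto simp: add_nonneg_eq_0_iff)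
    then show ?thesis unfolding E2 by (simp add: divide_simps) (simp add: power2_eq_square power3_eq_cube algebra_simps)
  qed
  also have "\<dots> \<ge> 0" using key E1 by (intro divide_nonneg_nonneg) auto
  finally have "t / 2 * (1 - 2 * \<alpha>) \<le> t + 1 - 1 / E - 2 * \<alpha> * (E - 1 / E)" by simp
  moreover have "C_alpha \<alpha> / 4 = t / 2 * (1 - 2 * \<alpha>)" by (simp add: C_alpha_def t_def)
  ultimately show ?thesis using 1 unfolding em E_def[symmetric] by linarith
qed

lemma C_alpha_le_information:
  fixes u :: "'a \<Rightarrow> real" and G :: "('a \<Rightarrow> bool) \<Rightarrow> 'a \<Rightarrow> real"
  assumes fin: "finite Y" "finite M" and u: "\<And>y. y \<in> Y \<Longrightarrow> 0 < u y" and u1: "(\<Sum>y\<in>Y. u y) = 1"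
    and G: "\<And>h y. h \<in> M \<Longrightarrow> y \<in> Y \<Longrightarrow> 0 \<le> G h y" and G1: "\<And>y. y \<in> Y \<Longrightarrow> (\<Sum>h\<in>M. G h y) = 1"
    and \<alpha>: "0 < \<alpha>" "\<alpha> < 1/2"
  defines "q \<equiv> \<lambda>h. \<Sum>y\<in>Y. u y * G h y"
  assumes err: "1/2 * (\<Sum>h\<in>M. \<Sum>y\<in>Y. u y * G h y * of_bool (\<not> h y))
      + 1/2 * (\<Sum>h\<in>M. \<Sum>y\<in>Y. u y * q h * of_bool (h y)) \<le> \<alpha>"
  shows "C_alpha \<alpha> / 4 \<le> (\<Sum>h\<in>M. ent Y u (G h))"
proof -
  define t where "t = ln ((1 - \<alpha>) / \<alpha>) / 2"
  define \<phi> where "\<phi> h y = (if h y then t else - t)" for h :: "'a \<Rightarrow> bool" and y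
  define p where "p = (\<Sum>h\<in>M. \<Sum>y\<in>Y. u y * G h y * of_bool (h y))"
  define s where "s = (\<Sum>h\<in>M. \<Sum>y\<in>Y. u y * q h * of_bool (h y))"
  have u0: "0 \<le> u y" if "y \<in> Y" for y using u[OF that] by simp
  have tot: "(\<Sum>h\<in>M. \<Sum>y\<in>Y. u y * G h y) = 1"
    by (subst sum.swap) (simp add: sum_distrib_left[symmetric] G1 u1)
  then have totq: "(\<Sum>h\<in>M. \<Sum>y\<in>Y. u y * q h) = 1"
    by (simp add: sum_distrib_right[symmetric] u1 q_def)
  have np: "(\<Sum>h\<in>M. \<Sum>y\<in>Y. u y * G h y * of_bool (\<not> h y)) = 1 - p"
    unfolding tot[symmetric] p_def sum_subtractf[symmetric] by (intro sum.cong) (auto simp: of_bool_def)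
  have ns: "(\<Sum>h\<in>M. \<Sum>y\<in>Y. u y * q h * of_bool (\<not> h y)) = 1 - s"
    unfolding totq[symmetric] s_def sum_subtractf[symmetric] by (intro sum.cong) (auto simp: of_bool_def)
  have "0 \<le> 1 - p" unfolding np[symmetric] using u0 G by (intro sum_nonneg) auto
  then have p1: "p \<le> 1" by simp
  have ps: "1 - 2 * \<alpha> + s \<le> p" using err unfolding np s_def[symmetric] by argo
  have q0: "0 \<le> q h" if "h \<in> M" for h unfolding q_def using u0 G that by (intro sum_nonneg) auto
  \<comment> \<open>Pointwise Donsker--Varadhan: the joint law is compared with the product of its
    marginals tilted by \<open>exp (\<phi> h y)\<close>.\<close>
  have pw: "u y * (G h y - q h * exp (\<phi> h y) + G h y * \<phi> h y) \<le> u y * (G h y * (ln (G h y) - ln (q h)))"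
    if h: "h \<in> M" and y: "y \<in> Y" for h y
  proof (rule mult_left_mono[OF _ less_imp_le[OF u[OF y]]])
    have z: "G h y = 0" if "q h = 0"
    proof -
      have "u y * G h y = 0"
        using that fin u0 G h y unfolding q_def
        by (subst (asm) sum_nonneg_eq_0_iff) auto
      then show ?thesis using u[OF y] by simp
    qed
    have "G h y - q h * exp (\<phi> h y) \<le> G h y * (ln (G h y) - ln (q h * exp (\<phi> h y)))"
      using G[OF h y] q0[OF h] z by (intro mult_ln_diff_ge) auto
    then show "G h y - q h * exp (\<phi> h y) + G h y * \<phi> h y \<le> G h y * (ln (G h y) - ln (q h))"
      using z q0[OF h] by (cases "q h = 0") (auto simp: ln_mult algebra_simps)
  qed
  have "t * (2 * p - 1) + 1 - s * exp t - (1 - s) * exp (- t)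
     = (\<Sum>h\<in>M. \<Sum>y\<in>Y. u y * G h y) - exp t * s - exp (- t) * (1 - s) + t * p - t * (1 - p)"
    unfolding tot by (simp add: algebra_simps)
  also have "\<dots> = (\<Sum>h\<in>M. \<Sum>y\<in>Y. u y * (G h y - q h * exp (\<phi> h y) + G h y * \<phi> h y))"
    unfolding np[symmetric] ns[symmetric] unfolding p_def s_def
      sum_distrib_left sum_subtractf[symmetric] sum.distrib[symmetric]
    by (intro sum.cong) (auto simp: \<phi>_def algebra_simps)
  also have "\<dots> \<le> (\<Sum>h\<in>M. \<Sum>y\<in>Y. u y * (G h y * (ln (G h y) - ln (q h))))"
    by (intro sum_mono pw)
  also have "\<dots> = (\<Sum>h\<in>M. ent Y u (G h))" by (simp add: ent_alt q_def)
  finally show ?thesis using C_alpha_le_dual_value[OF \<alpha> p1 ps] unfolding t_def by linarith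
qed

text \<open>Information is at most the entropy of the output: the conditional terms
  \<open>G ln G\<close> are nonpositive. The log-sum inequality against the constant 1 then bounds
  the entropy of \<open>q\<close>.\<close>

lemma sum_ent_le_ln_card:
  assumes fin: "finite Y" "finite M" and u: "\<And>y. y \<in> Y \<Longrightarrow> 0 \<le> u y" and u1: "(\<Sum>y\<in>Y. u y) = 1"
    and G: "\<And>h y. h \<in> M \<Longrightarrow> y \<in> Y \<Longrightarrow> 0 \<le> G h y" and G1: "\<And>y. y \<in> Y \<Longrightarrow> (\<Sum>h\<in>M. G h y) = 1"
  shows "(\<Sum>h\<in>M. ent Y u (G h)) \<le> ln (real (card M))"
proof -
  define q where "q h = (\<Sum>y\<in>Y. u y * G h y)" for h
  have q0: "0 \<le> q h" if "h \<in> M" for h unfolding q_def using u G that by (intro sum_nonneg) auto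
  have q1: "(\<Sum>h\<in>M. q h) = 1" unfolding q_def
    by (subst sum.swap) (simp add: sum_distrib_left[symmetric] G1 u1)
  have "ent Y u (G h) \<le> - (q h * ln (q h))" if h: "h \<in> M" for h
  proof -
    have "u y * (G h y * ln (G h y)) \<le> 0" if y: "y \<in> Y" for y
    proof -
      have "G h y \<le> 1" unfolding G1[OF y, symmetric] using G y h fin by (intro member_le_sum) auto
      then have "G h y * ln (G h y) \<le> 0" using G[OF h y]
        by (cases "G h y = 0") (auto intro!: mult_nonneg_nonpos)
      then show ?thesis by (rule mult_nonneg_nonpos[OF u[OF y]])
    qed
    then have "(\<Sum>y\<in>Y. u y * (G h y * ln (G h y))) \<le> 0" by (intro sum_nonpos)
    then show ?thesis by (simp add: ent_def q_def)
  qed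
  then have "(\<Sum>h\<in>M. ent Y u (G h)) \<le> (\<Sum>h\<in>M. - (q h * ln (q h)))" by (intro sum_mono)
  also have "\<dots> \<le> ln (real (card M))"
    using log_sum_inequality[of M "\<lambda>_. 1" q "\<lambda>_. 1"] q0 fin q1 by (simp add: sum_negf)
  finally show ?thesis .
qed

text \<open>Information is at most the entropy of the uniform input, since
  \<open>c * G h y \<le> q h\<close> caps each density ratio by \<open>1 / c\<close>.\<close>

lemma sum_ent_uniform_le:
  assumes fin: "finite Y" "finite M" and c: "0 < c" and u1: "(\<Sum>y\<in>Y. c) = 1"
    and G: "\<And>h y. h \<in> M \<Longrightarrow> y \<in> Y \<Longrightarrow> 0 \<le> G h y" and G1: "\<And>y. y \<in> Y \<Longrightarrow> (\<Sum>h\<in>M. G h y) = 1"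
  shows "(\<Sum>h\<in>M. ent Y (\<lambda>_. c) (G h)) \<le> ln (1 / c)"
proof -
  define q where "q h = (\<Sum>y\<in>Y. c * G h y)" for h
  have pw: "c * (G h y * (ln (G h y) - ln (q h))) \<le> c * (G h y * ln (1 / c))" if h: "h \<in> M" and y: "y \<in> Y" for h y
  proof (cases "G h y = 0")
    case False
    then have Gp: "0 < G h y" using G[OF h y] by simp
    have le: "c * G h y \<le> q h" unfolding q_def using fin y G h c by (intro member_le_sum) auto
    have cG: "0 < c * G h y" using c Gp by simp
    then have "ln (c * G h y) \<le> ln (q h)" using le by simp
    then have "ln (G h y) - ln (q h) \<le> ln (1 / c)" using c Gp by (simp add: ln_mult ln_div)
    then show ?thesis using c Gp by (simp add: mult_left_mono)
  qed simp
  have "(\<Sum>h\<in>M. ent Y (\<lambda>_. c) (G h)) \<le> (\<Sum>h\<in>M. \<Sum>y\<in>Y. c * (G h y * ln (1 / c)))"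
    unfolding ent_alt q_def[symmetric] by (intro sum_mono pw)
  also have "\<dots> = (\<Sum>y\<in>Y. c * (\<Sum>h\<in>M. G h y)) * ln (1 / c)"
    by (subst sum.swap) (simp add: sum_distrib_left sum_distrib_right mult.assoc)
  also have "\<dots> = ln (1 / c)" using G1 u1 by simp
  finally show ?thesis .
qed

section \<open>Finite-sum form of the model\<close>

definition vecw :: "real \<Rightarrow> nat \<Rightarrow> (nat \<Rightarrow> int) \<Rightarrow> (nat \<Rightarrow> int) \<Rightarrow> real" where
  "vecw lam d \<theta> y = (\<Prod>i<d. bw lam (\<theta> i) (y i))"

definition smpw :: "real \<Rightarrow> nat \<Rightarrow> nat \<Rightarrow> (nat \<Rightarrow> int) \<Rightarrow> (nat \<Rightarrow> nat \<Rightarrow> int) \<Rightarrow> real" where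
  "smpw lam d n \<theta> xs = (\<Prod>j<n. vecw lam d \<theta> (xs j))"

lemma finite_cube [simp]: "finite (cube d)"
  by (auto simp: cube_def intro!: finite_PiE)

lemma finite_sample_space [simp]: "finite (sample_space d n)"
  by (auto simp: sample_space_def intro!: finite_PiE)

lemma card_cube: "card (cube d) = 2 ^ d"
  by (simp add: cube_def card_PiE numeral_2_eq_2)

lemma cube_nonempty [simp]: "cube d \<noteq> {}"
  by (auto simp: cube_def PiE_eq_empty_iff)

lemma cubeD: "x \<in> cube d \<Longrightarrow> i < d \<Longrightarrow> x i \<in> {-1, 1}"
  by (auto simp: cube_def PiE_iff)

lemma sample_spaceD: "xs \<in> sample_space d n \<Longrightarrow> j < n \<Longrightarrow> xs j \<in> cube d"
  by (auto simp: sample_space_def PiE_iff)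

lemma vecw_nonneg: "0 \<le> lam \<Longrightarrow> lam \<le> 1 \<Longrightarrow> \<theta> \<in> cube d \<Longrightarrow> y \<in> cube d \<Longrightarrow> 0 \<le> vecw lam d \<theta> y"
  unfolding vecw_def by (intro prod_nonneg) (auto intro!: bw_nonneg dest: cubeD)

lemma smpw_nonneg: "0 \<le> lam \<Longrightarrow> lam \<le> 1 \<Longrightarrow> \<theta> \<in> cube d \<Longrightarrow> xs \<in> sample_space d n \<Longrightarrow> 0 \<le> smpw lam d n \<theta> xs"
  unfolding smpw_def by (intro prod_nonneg) (auto intro!: vecw_nonneg dest: sample_spaceD)

lemma vecw_commute: "vecw lam d \<theta> y = vecw lam d y \<theta>"
  by (simp add: vecw_def bw_commute)

lemma sum_cube_prod:
  fixes F :: "nat \<Rightarrow> int \<Rightarrow> real"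
  shows "(\<Sum>x\<in>cube d. \<Prod>i<d. F i (x i)) = (\<Prod>i<d. \<Sum>v\<in>{-1, 1}. F i v)"
  unfolding cube_def by (rule sum_PiE_prod) simp

lemma sum_vecw: "\<theta> \<in> cube d \<Longrightarrow> (\<Sum>y\<in>cube d. vecw lam d \<theta> y) = 1"
  unfolding vecw_def by (subst sum_cube_prod) (intro prod.neutral ballI sum_bw, auto dest: cubeD)

lemma sum_smpw: "\<theta> \<in> cube d \<Longrightarrow> (\<Sum>xs\<in>sample_space d n. smpw lam d n \<theta> xs) = 1"
  unfolding smpw_def sample_space_def by (subst sum_PiE_prod) (auto simp: sum_vecw)

definition flip_pmf :: "real \<Rightarrow> int \<Rightarrow> int pmf" where
  "flip_pmf lam s = map_pmf (\<lambda>b. if b then - s else s) (bernoulli_pmf ((1 - lam) / 2))"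

lemma pmf_flip:
  assumes "0 \<le> lam" "lam \<le> 1" "s \<in> {-1, 1}" "v \<in> {-1, 1}"
  shows "pmf (flip_pmf lam s) v = bw lam s v"
proof -
  have "pmf (flip_pmf lam s) v = measure_pmf.prob (bernoulli_pmf ((1 - lam) / 2)) {b. (if b then - s else s) = v}"
    by (simp add: flip_pmf_def pmf_map vimage_def)
  also have "{b. (if b then - s else s) = v} = {v \<noteq> s}" using assms by (auto split: if_splits)
  finally show ?thesis using assms by (auto simp: measure_pmf_single bw_def field_simps)
qed

lemma set_flip: "s \<in> {-1, 1} \<Longrightarrow> set_pmf (flip_pmf lam s) \<subseteq> {-1, 1}"
  by (auto simp: flip_pmf_def split: if_splits)

lemma planted_eq: "planted d lam \<theta> = Pi_pmf {0..<d} undefined (\<lambda>i. flip_pmf lam (\<theta> i))"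
  by (simp add: planted_def bsc_def flip_pmf_def)

text \<open>With default value \<open>undefined\<close>, product pmfs live on exactly the
  extensional functions that form the cube and the sample space.\<close>

lemma PiE_dflt_undefined: "PiE_dflt A undefined B = PiE A B"
  by (auto simp: PiE_dflt_def PiE_def extensional_def)

lemma pmf_planted:
  assumes "0 \<le> lam" "lam \<le> 1" "\<theta> \<in> cube d" "y \<in> cube d"
  shows "pmf (planted d lam \<theta>) y = vecw lam d \<theta> y"
  unfolding planted_eq using assms
  by (subst pmf_Pi')
     (auto simp: vecw_def cube_def PiE_iff extensional_def atLeast0LessThan intro!: prod.cong pmf_flip)

lemma set_planted: "\<theta> \<in> cube d \<Longrightarrow> set_pmf (planted d lam \<theta>) \<subseteq> cube d"
  unfolding planted_eq cube_def PiE_dflt_undefined[symmetric]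
  by (subst set_Pi_pmf) (use set_flip in \<open>auto simp: PiE_dflt_def, blast+\<close>)

lemma pmf_samples:
  assumes "0 \<le> lam" "lam \<le> 1" "\<theta> \<in> cube d" "xs \<in> sample_space d n"
  shows "pmf (samples n (planted d lam \<theta>)) xs = smpw lam d n \<theta> xs"
  unfolding samples_def using assms
  by (subst pmf_Pi')
     (auto simp: smpw_def sample_space_def PiE_iff extensional_def atLeast0LessThan intro!: prod.cong pmf_planted)

lemma set_samples: "\<theta> \<in> cube d \<Longrightarrow> set_pmf (samples n (planted d lam \<theta>)) \<subseteq> sample_space d n"
  unfolding samples_def sample_space_def PiE_dflt_undefined[symmetric]
  by (subst set_Pi_pmf) (use set_planted in \<open>auto simp: PiE_dflt_def, blast+\<close>)

lemma expectation_cube_uniform: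
  fixes f :: "(nat \<Rightarrow> int) \<Rightarrow> real"
  shows "measure_pmf.expectation (pmf_of_set (cube d)) f = (\<Sum>\<theta>\<in>cube d. 1 / 2 ^ d * f \<theta>)"
  by (simp add: integral_pmf_of_set card_cube sum_divide_distrib)

lemma expectation_samples:
  assumes "0 \<le> lam" "lam \<le> 1" "\<theta> \<in> cube d"
  shows "measure_pmf.expectation (samples n (planted d lam \<theta>)) f = (\<Sum>xs\<in>sample_space d n. smpw lam d n \<theta> xs * f xs)"
  by (subst integral_measure_pmf_real[where A = "sample_space d n"])
     (use assms set_samples[of \<theta> d n lam] in \<open>auto simp: pmf_samples mult.commute\<close>)

lemma prob_planted:
  assumes "0 \<le> lam" "lam \<le> 1" "\<theta> \<in> cube d"
  shows "measure_pmf.prob (planted d lam \<theta>) {x. Q x} = (\<Sum>y\<in>cube d. vecw lam d \<theta> y * of_bool (Q y))"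
proof -
  have "measure_pmf.prob (planted d lam \<theta>) {x. Q x} = measure_pmf.expectation (planted d lam \<theta>) (indicator {x. Q x})"
    by simp
  also have "\<dots> = (\<Sum>y\<in>cube d. vecw lam d \<theta> y * of_bool (Q y))"
    by (subst integral_measure_pmf_real[where A = "cube d"])
       (use assms set_planted[of \<theta> d lam] in \<open>auto simp: pmf_planted indicator_def mult.commute intro!: sum.cong\<close>)
  finally show ?thesis .
qed

lemma prob_null: "measure_pmf.prob (null_dist d) {x. Q x} = (\<Sum>y\<in>cube d. 1 / 2 ^ d * of_bool (Q y))"
proof -
  have "measure_pmf.prob (null_dist d) {x. Q x} = measure_pmf.expectation (null_dist d) (indicator {x. Q x})"
    by simp
  also have "\<dots> = (\<Sum>y\<in>cube d. 1 / 2 ^ d * of_bool (Q y))"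
    unfolding null_dist_def expectation_cube_uniform by (intro sum.cong) (auto simp: indicator_def)
  finally show ?thesis .
qed

text \<open>The logarithm of the quotient splits into a difference only where the term has positive
  weight; there \<open>q h\<close> is positive too. All other terms vanish on both sides.\<close>

lemma mi_given_eq:
  assumes "0 \<le> lam" "lam \<le> 1" "\<theta> \<in> cube d"
  shows "mi_given d lam n M A \<theta> = (\<Sum>h\<in>M. ent (sample_space d n) (smpw lam d n \<theta>) (\<lambda>xs. pmf (A xs) h))"
proof -
  define q where "q h = (\<Sum>xs\<in>sample_space d n. smpw lam d n \<theta> xs * pmf (A xs) h)" for h
  have pw: "smpw lam d n \<theta> xs * pmf (A xs) h * ln (pmf (A xs) h / q h)
     = smpw lam d n \<theta> xs * (pmf (A xs) h * (ln (pmf (A xs) h) - ln (q h)))" if xs: "xs \<in> sample_space d n" for xs h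
  proof (cases "smpw lam d n \<theta> xs * pmf (A xs) h = 0")
    case False
    have le: "smpw lam d n \<theta> xs * pmf (A xs) h \<le> q h" unfolding q_def using xs
      by (intro member_le_sum) (auto intro!: mult_nonneg_nonneg smpw_nonneg assms)
    have "0 < smpw lam d n \<theta> xs * pmf (A xs) h"
      using False smpw_nonneg[OF assms xs] by (auto simp: less_le)
    with le False show ?thesis by (subst ln_div) (auto simp: less_le)
  qed auto
  have "mi_given d lam n M A \<theta> = (\<Sum>xs\<in>sample_space d n. \<Sum>h\<in>M.
       smpw lam d n \<theta> xs * pmf (A xs) h * ln (pmf (A xs) h / q h))"
    unfolding mi_given_def Let_def q_def using assms by (simp add: pmf_samples)
  also have "\<dots> = (\<Sum>h\<in>M. \<Sum>xs\<in>sample_space d n. smpw lam d n \<theta> xs * (pmf (A xs) h * (ln (pmf (A xs) h) - ln (q h))))"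
    by (subst sum.swap) (simp add: pw)
  finally show ?thesis by (simp add: ent_alt q_def)
qed

lemma mem_eq:
  assumes "0 \<le> lam" "lam \<le> 1"
  shows "mem d lam n M A = (\<Sum>h\<in>M.
      ent (sample_space d n) (\<lambda>xs. \<Sum>\<theta>\<in>cube d. 1 / 2 ^ d * smpw lam d n \<theta> xs) (\<lambda>xs. pmf (A xs) h)
    - ent (cube d) (\<lambda>_. 1 / 2 ^ d) (\<lambda>\<theta>. \<Sum>xs\<in>sample_space d n. smpw lam d n \<theta> xs * pmf (A xs) h))"
proof -
  have "mem d lam n M A = (\<Sum>\<theta>\<in>cube d. \<Sum>h\<in>M. 1 / 2 ^ d * ent (sample_space d n) (smpw lam d n \<theta>) (\<lambda>xs. pmf (A xs) h))"
    unfolding mem_def prior_def expectation_cube_uniform using assms by (simp add: mi_given_eq sum_distrib_left)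
  also have "\<dots> = (\<Sum>h\<in>M. \<Sum>\<theta>\<in>cube d. 1 / 2 ^ d * ent (sample_space d n) (smpw lam d n \<theta>) (\<lambda>xs. pmf (A xs) h))"
    by (rule sum.swap)
  finally show ?thesis unfolding ent_compensation .
qed

text \<open>Exchanging the sums leaves only the law of \<open>h\<close> given \<theta>, the quantity
  on which the information bounds operate.\<close>

lemma err_alg_eq:
  assumes lam: "0 \<le> lam" "lam \<le> 1" and A: "is_algorithm M A"
  shows "err_alg d lam n A = (\<Sum>\<theta>\<in>cube d. 1 / 2 ^ d * (\<Sum>h\<in>M.
    (\<Sum>xs\<in>sample_space d n. smpw lam d n \<theta> xs * pmf (A xs) h) *
    (1/2 * (\<Sum>y\<in>cube d. vecw lam d \<theta> y * of_bool (\<not> h y)) + 1/2 * (\<Sum>y\<in>cube d. 1 / 2 ^ d * of_bool (h y)))))"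
proof -
  have E: "measure_pmf.expectation (A xs) F = (\<Sum>h\<in>M. pmf (A xs) h * F h)" for xs and F :: "_ \<Rightarrow> real"
    by (subst integral_measure_pmf_real[where A = M]) (use A in \<open>auto simp: is_algorithm_def mult.commute\<close>)
  have "err_alg d lam n A = (\<Sum>\<theta>\<in>cube d. 1 / 2 ^ d * (\<Sum>xs\<in>sample_space d n. smpw lam d n \<theta> xs * (\<Sum>h\<in>M. pmf (A xs) h * err_h d lam \<theta> h)))"
    unfolding err_alg_def prior_def expectation_cube_uniform E using lam
    by (simp add: expectation_samples)
  also have "\<dots> = (\<Sum>\<theta>\<in>cube d. 1 / 2 ^ d * (\<Sum>h\<in>M. (\<Sum>xs\<in>sample_space d n. smpw lam d n \<theta> xs * pmf (A xs) h) * err_h d lam \<theta> h))"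
    unfolding sum_distrib_left sum_distrib_right by (subst (2) sum.swap) (simp add: mult.assoc)
  finally show ?thesis unfolding err_h_def prob_null using lam by (simp add: prob_planted)
qed

section \<open>Memorization lower bound\<close>

text \<open>Transposition. Samples are rows, but given \<theta> the independent one-coordinate
  channels are the columns. The restrictions keep the result extensional, so swapping the dimensions
  gives the inverse.\<close>

definition samples_of_columns :: "nat \<Rightarrow> nat \<Rightarrow> (nat \<Rightarrow> nat \<Rightarrow> int) \<Rightarrow> nat \<Rightarrow> nat \<Rightarrow> int" where
  "samples_of_columns d n c = (\<lambda>j\<in>{0..<n}. \<lambda>i\<in>{0..<d}. c i j)"

lemma bij_betw_samples_of_columns:
  "bij_betw (samples_of_columns d n) (PiE {0..<d} (\<lambda>_. signs n)) (sample_space d n)"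
proof (rule bij_betw_byWitness[where f' = "samples_of_columns n d"])
  have inv: "samples_of_columns b a (samples_of_columns a b c) = c" if "c \<in> PiE {0..<a} (\<lambda>_. signs b)" for a b c
  proof
    fix i
    show "samples_of_columns b a (samples_of_columns a b c) i = c i"
    proof (cases "i < a")
      case True
      then have "c i \<in> extensional {0..<b}" using that by (auto simp: PiE_iff)
      then show ?thesis using True by (auto simp: samples_of_columns_def fun_eq_iff extensional_def)
    next
      case False
      then show ?thesis using that by (auto simp: samples_of_columns_def PiE_iff extensional_def)
    qed
  qed
  have img: "samples_of_columns a b ` PiE {0..<a} (\<lambda>_. signs b) \<subseteq> PiE {0..<b} (\<lambda>_. signs a)" for a b
  proof clarify
    fix c assume c: "c \<in> PiE {0..<a} (\<lambda>_. signs b)"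
    then have "c i j \<in> {-1, 1}" if "i < a" "j < b" for i j using that by (fastforce simp: PiE_iff)
    then show "samples_of_columns a b c \<in> PiE {0..<b} (\<lambda>_. signs a)"
      unfolding samples_of_columns_def by (intro restrict_PiE_iff[THEN iffD2] ballI) auto
  qed
  show "\<forall>c\<in>PiE {0..<d} (\<lambda>_. signs n). samples_of_columns n d (samples_of_columns d n c) = c"
    using inv by blast
  show "\<forall>c\<in>sample_space d n. samples_of_columns d n (samples_of_columns n d c) = c"
    unfolding sample_space_def cube_def using inv by blast
  show "samples_of_columns d n ` PiE {0..<d} (\<lambda>_. signs n) \<subseteq> sample_space d n"
    unfolding sample_space_def cube_def by (rule img)
  show "samples_of_columns n d ` sample_space d n \<subseteq> PiE {0..<d} (\<lambda>_. signs n)"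
    unfolding sample_space_def cube_def by (rule img)
qed

lemma smpw_samples_of_columns:
  "smpw lam d n \<theta> (samples_of_columns d n c) = (\<Prod>i<d. colw lam n (\<theta> i) (c i))"
proof -
  have "smpw lam d n \<theta> (samples_of_columns d n c) = (\<Prod>j<n. \<Prod>i<d. bw lam (\<theta> i) (c i j))"
    unfolding smpw_def vecw_def samples_of_columns_def by (intro prod.cong) auto
  also have "\<dots> = (\<Prod>i<d. \<Prod>j<n. bw lam (\<theta> i) (c i j))" by (rule prod.swap)
  finally show ?thesis by (simp add: colw_def)
qed

lemma colw_nonneg: "0 \<le> lam \<Longrightarrow> lam \<le> 1 \<Longrightarrow> s \<in> {-1, 1} \<Longrightarrow> x \<in> signs n \<Longrightarrow> 0 \<le> colw lam n s x"
  unfolding colw_def by (intro prod_nonneg) (auto intro!: bw_nonneg simp: PiE_iff)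

lemma sdpi_samples:
  assumes lam: "0 < lam" "lam \<le> 1/2" and n: "1 \<le> n" "real n * lam\<^sup>2 \<le> 1"
  shows "sdpi (sample_space d n) (cube d) (\<lambda>_. 1 / 2 ^ d) (smpw lam d n) (16 * (lam\<^sup>2 * real n))"
proof (rule sdpi_reindex[OF bij_betw_samples_of_columns, where \<psi> = "\<lambda>x. x"])
  show "bij_betw (\<lambda>x. x) (signs d) (cube d)" by (simp add: cube_def bij_betw_def)
  show "sdpi (PiE {0..<d} (\<lambda>_. signs n)) (signs d) (\<lambda>y. \<Prod>i<d. 1/2) (\<lambda>y x. \<Prod>i<d. colw lam n (y i) (x i)) (16 * (lam\<^sup>2 * real n))"
    using lam n by (intro sdpi_power sdpi_columns) (auto intro!: finite_PiE colw_nonneg)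
qed (simp_all add: smpw_samples_of_columns power_one_over)

text \<open>Under the uniform prior a fresh sample is uniform, and by symmetry of \<open>bw\<close>
  the posterior of \<theta> given it is again \<open>vecw\<close>; the backward channel is a power
  of the binary symmetric one.\<close>

lemma sdpi_test_point:
  assumes lam: "0 < lam" "lam \<le> 1"
  shows "sdpi (cube d) (cube d) (\<lambda>_. 1 / 2 ^ d) (vecw lam d) (2 * lam\<^sup>2)"
proof -
  have "sdpi (signs d) (signs d) (\<lambda>y. \<Prod>i<d. 1/2) (\<lambda>y x. \<Prod>i<d. bw lam (y i) (x i)) (2 * lam\<^sup>2)"
    using lam by (intro sdpi_power sdpi_bsc) (auto intro!: bw_nonneg)
  then show ?thesis by (simp add: cube_def vecw_def[abs_def] power_one_over)
qed

lemma ent_weight_cong: "(\<And>x. x \<in> A \<Longrightarrow> w x = v x) \<Longrightarrow> ent A w f = ent A v f"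
  unfolding ent_def by simp

lemma mem_nonneg:
  assumes "0 \<le> lam" "lam \<le> 1"
  shows "0 \<le> mem d lam n M A"
  unfolding mem_def prior_def expectation_cube_uniform using assms
  by (intro sum_nonneg mult_nonneg_nonneg) (auto simp: mi_given_eq intro!: sum_nonneg ent_nonneg smpw_nonneg sum_smpw)

text \<open>The quantity \<open>I\<close> is I(h;\<theta>), and \<open>mem + I\<close> is I(h;X).
  The first bound chains the error bound C \<le> 4 I(h;X') with contraction to the fresh sample X'.
  The next two use the entropy of \<theta> and of the output, and the last is contraction from X to
  \<theta>.\<close>

lemma information_bounds:
  assumes lam: "0 < lam" "lam \<le> 1" and n: "1 \<le> n" and \<alpha>: "0 < \<alpha>" "\<alpha> < 1/2"
    and A: "is_algorithm M A" and err: "err_alg d lam n A \<le> \<alpha>"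
  obtains I where "C_alpha \<alpha> \<le> 8 * lam\<^sup>2 * I" "I \<le> real d * ln 2" "C_alpha \<alpha> \<le> 4 * ln (real (card M))"
    "lam \<le> 1/2 \<Longrightarrow> real n * lam\<^sup>2 \<le> 1 \<Longrightarrow> I \<le> 16 * (lam\<^sup>2 * real n) * (mem d lam n M A + I)"
proof -
  define U :: real where "U = 1 / 2 ^ d"
  define f where "f h xs = pmf (A xs) h" for h xs
  \<comment> \<open>\<open>T\<close> and \<open>G\<close> are the probabilities of \<open>h\<close>
    given \<theta> and given a fresh sample, so \<open>I\<close>, \<open>IX\<close> and
    \<open>IY\<close> are the information of \<open>h\<close> about \<theta>, X and X'.\<close>
  define T where "T h \<theta> = (\<Sum>xs\<in>sample_space d n. smpw lam d n \<theta> xs * f h xs)" for h \<theta>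
  define G where "G h y = (\<Sum>\<theta>\<in>cube d. vecw lam d y \<theta> * T h \<theta>)" for h y
  define I where "I = (\<Sum>h\<in>M. ent (cube d) (\<lambda>_. U) (T h))"
  define IX where "IX = (\<Sum>h\<in>M. ent (sample_space d n) (\<lambda>xs. \<Sum>\<theta>\<in>cube d. U * smpw lam d n \<theta> xs) (f h))"
  define IY where "IY = (\<Sum>h\<in>M. ent (cube d) (\<lambda>_. U) (G h))"
  have finM: "finite M" using A by (simp add: is_algorithm_def)
  have U: "0 < U" "(\<Sum>y\<in>cube d. U) = 1" by (simp_all add: U_def card_cube)
  have f1: "(\<Sum>h\<in>M. f h xs) = 1" for xs
    unfolding f_def using A by (intro sum_pmf_eq_1) (auto simp: is_algorithm_def)
  have T0: "0 \<le> T h \<theta>" if "\<theta> \<in> cube d" for h \<theta>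
    unfolding T_def f_def using lam that by (intro sum_nonneg mult_nonneg_nonneg smpw_nonneg) auto
  have T1: "(\<Sum>h\<in>M. T h \<theta>) = 1" if "\<theta> \<in> cube d" for \<theta>
    unfolding T_def by (subst sum.swap) (simp add: sum_distrib_left[symmetric] f1 sum_smpw that)
  have G0: "0 \<le> G h y" if "y \<in> cube d" for h y
    unfolding G_def using lam that by (intro sum_nonneg mult_nonneg_nonneg vecw_nonneg T0) auto
  have G1: "(\<Sum>h\<in>M. G h y) = 1" if "y \<in> cube d" for y
    unfolding G_def by (subst sum.swap) (simp add: sum_distrib_left[symmetric] T1 sum_vecw that)
  have col: "(\<Sum>y\<in>cube d. vecw lam d y \<theta>) = 1" if "\<theta> \<in> cube d" for \<theta>
    using sum_vecw[OF that, of lam] by (simp add: vecw_commute)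
  have mem: "mem d lam n M A = IX - I"
    using lam by (simp add: mem_eq IX_def I_def sum_subtractf U_def f_def[abs_def] T_def[abs_def])
  have "ent (cube d) (\<lambda>_. U) (G h) \<le> 2 * lam\<^sup>2 * ent (cube d) (\<lambda>_. U) (T h)" for h
  proof -
    have "ent (cube d) (\<lambda>_. U) (G h) \<le> 2 * lam\<^sup>2 * ent (cube d) (\<lambda>x. \<Sum>y\<in>cube d. U * vecw lam d y x) (T h)"
      using sdpi_test_point[OF lam, of d] T0 unfolding sdpi_def G_def[abs_def] U_def by blast
    also have "ent (cube d) (\<lambda>x. \<Sum>y\<in>cube d. U * vecw lam d y x) (T h) = ent (cube d) (\<lambda>_. U) (T h)"
      by (rule ent_weight_cong) (simp add: sum_distrib_left[symmetric] col)
    finally show ?thesis .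
  qed
  then have IY: "IY \<le> 2 * lam\<^sup>2 * I" unfolding IY_def I_def sum_distrib_left by (rule sum_mono)
  \<comment> \<open>Conditioning on \<theta> or on X' gives the same marginal law of
    \<open>h\<close>.\<close>
  have q: "(\<Sum>y\<in>cube d. U * G h y) = (\<Sum>\<theta>\<in>cube d. U * T h \<theta>)" for h
  proof -
    have "(\<Sum>y\<in>cube d. U * G h y) = (\<Sum>\<theta>\<in>cube d. U * T h \<theta> * (\<Sum>y\<in>cube d. vecw lam d y \<theta>))"
      unfolding G_def sum_distrib_left by (subst sum.swap) (simp add: algebra_simps)
    then show ?thesis by (simp add: col)
  qed
  \<comment> \<open>The planted term is an event of the joint law of (h, X'). The null point is
    uniform and independent of \<open>h\<close>, so the null term is an event of the product of the
    marginals.\<close>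
  have "err_alg d lam n A = (\<Sum>\<theta>\<in>cube d. \<Sum>h\<in>M. 1/2 * (\<Sum>y\<in>cube d. U * (vecw lam d y \<theta> * T h \<theta>) * of_bool (\<not> h y))
      + 1/2 * (\<Sum>y\<in>cube d. U * (U * T h \<theta>) * of_bool (h y)))"
    using lam A by (simp add: err_alg_eq[where M = M] T_def[symmetric] f_def[symmetric] U_def[symmetric])
      (simp add: sum_distrib_left algebra_simps vecw_commute)
  also have "\<dots> = 1/2 * (\<Sum>\<theta>\<in>cube d. \<Sum>h\<in>M. \<Sum>y\<in>cube d. U * (vecw lam d y \<theta> * T h \<theta>) * of_bool (\<not> h y))
      + 1/2 * (\<Sum>\<theta>\<in>cube d. \<Sum>h\<in>M. \<Sum>y\<in>cube d. U * (U * T h \<theta>) * of_bool (h y))"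
    by (simp add: sum.distrib sum_distrib_left)
  also have "(\<Sum>\<theta>\<in>cube d. \<Sum>h\<in>M. \<Sum>y\<in>cube d. U * (vecw lam d y \<theta> * T h \<theta>) * of_bool (\<not> h y))
     = (\<Sum>h\<in>M. \<Sum>y\<in>cube d. \<Sum>\<theta>\<in>cube d. U * (vecw lam d y \<theta> * T h \<theta>) * of_bool (\<not> h y))"
    by (subst sum.swap, rule sum.cong[OF refl], rule sum.swap)
  also have "\<dots> = (\<Sum>h\<in>M. \<Sum>y\<in>cube d. U * G h y * of_bool (\<not> h y))"
    by (simp only: G_def sum_distrib_left sum_distrib_right)
  also have "(\<Sum>\<theta>\<in>cube d. \<Sum>h\<in>M. \<Sum>y\<in>cube d. U * (U * T h \<theta>) * of_bool (h y))
     = (\<Sum>h\<in>M. \<Sum>y\<in>cube d. \<Sum>\<theta>\<in>cube d. U * (U * T h \<theta>) * of_bool (h y))"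
    by (subst sum.swap, rule sum.cong[OF refl], rule sum.swap)
  also have "\<dots> = (\<Sum>h\<in>M. \<Sum>y\<in>cube d. U * (\<Sum>y\<in>cube d. U * G h y) * of_bool (h y))"
    by (simp only: q) (simp only: sum_distrib_left sum_distrib_right)
  finally have err_eq: "err_alg d lam n A = 1/2 * (\<Sum>h\<in>M. \<Sum>y\<in>cube d. U * G h y * of_bool (\<not> h y))
     + 1/2 * (\<Sum>h\<in>M. \<Sum>y\<in>cube d. U * (\<Sum>y\<in>cube d. U * G h y) * of_bool (h y))" .
  have C: "C_alpha \<alpha> / 4 \<le> IY" unfolding IY_def
    by (rule C_alpha_le_information) (use finM U G0 G1 \<alpha> err in \<open>auto simp: err_eq\<close>)
  show thesis
  proof (rule that[of I])
    show "C_alpha \<alpha> \<le> 8 * lam\<^sup>2 * I" using C IY by simp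
    have "I \<le> ln (1 / U)" unfolding I_def using finM U T0 T1 by (intro sum_ent_uniform_le) auto
    then show "I \<le> real d * ln 2" by (simp add: U_def ln_realpow)
    have "IY \<le> ln (real (card M))" unfolding IY_def using finM U G0 G1 by (intro sum_ent_le_ln_card) auto
    then show "C_alpha \<alpha> \<le> 4 * ln (real (card M))" using C by simp
    assume l: "lam \<le> 1/2" "real n * lam\<^sup>2 \<le> 1"
    have "ent (cube d) (\<lambda>_. U) (T h) \<le> 16 * (lam\<^sup>2 * real n) *
       ent (sample_space d n) (\<lambda>xs. \<Sum>\<theta>\<in>cube d. U * smpw lam d n \<theta> xs) (f h)" for h
      using sdpi_samples[OF lam(1) l(1) n l(2), of d] unfolding sdpi_def T_def[abs_def] U_def f_def by simp
    then have "I \<le> 16 * (lam\<^sup>2 * real n) * IX" unfolding I_def IX_def sum_distrib_left by (rule sum_mono)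
    then show "I \<le> 16 * (lam\<^sup>2 * real n) * (mem d lam n M A + I)" using mem by simp
  qed
qed

text \<open>With z = lam^2 n, contraction gives I \<le> 16 z (mem + I), hence I (1 - 16 z) \<le> 16
  z mem. Inserting C \<le> 8 lam^2 I produces the constant 128 = 8 * 16.\<close>

lemma mem_lower_bound:
  assumes lam: "0 < lam" and n: "1 \<le> n" and x: "lam\<^sup>2 * real n \<le> 1/16" and \<alpha>: "0 < \<alpha>" "\<alpha> < 1/2"
    and A: "is_algorithm M A" and err: "err_alg d lam n A \<le> \<alpha>"
  shows "C_alpha \<alpha> * (1 - 16 * (lam\<^sup>2 * real n)) / (128 * (lam ^ 4 * real n)) \<le> mem d lam n M A"
proof -
  have "lam\<^sup>2 * 1 \<le> lam\<^sup>2 * real n" using n by (intro mult_left_mono) auto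
  then have "lam\<^sup>2 \<le> (1/4)\<^sup>2" using x by (simp add: power2_eq_square)
  then have l4: "lam \<le> 1/4" by (rule power2_le_imp_le) simp
  obtain I where C: "C_alpha \<alpha> \<le> 8 * lam\<^sup>2 * I" and
    I: "lam \<le> 1/2 \<Longrightarrow> real n * lam\<^sup>2 \<le> 1 \<Longrightarrow> I \<le> 16 * (lam\<^sup>2 * real n) * (mem d lam n M A + I)"
    using information_bounds[of lam n \<alpha> M A d] assms l4 by auto
  define z where "z = lam\<^sup>2 * real n"
  have z: "0 < z" using lam n by (simp add: z_def)
  have "I \<le> 16 * z * (mem d lam n M A + I)" using I l4 x unfolding z_def by (simp add: mult.commute)
  then have "I * (1 - 16 * z) \<le> 16 * z * mem d lam n M A" by (simp add: algebra_simps)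
  moreover have "C_alpha \<alpha> * (1 - 16 * z) \<le> 8 * lam\<^sup>2 * I * (1 - 16 * z)"
    using C x unfolding z_def by (intro mult_right_mono) auto
  ultimately have "C_alpha \<alpha> * (1 - 16 * z) \<le> 8 * lam\<^sup>2 * (16 * z * mem d lam n M A)"
    using mult_left_mono[of "I * (1 - 16 * z)" "16 * z * mem d lam n M A" "8 * lam\<^sup>2"] by (simp add: algebra_simps)
  also have "\<dots> = mem d lam n M A * (128 * (lam ^ 4 * real n))"
    by (simp add: z_def power2_eq_square power4_eq_xxxx)
  finally show ?thesis using lam n unfolding z_def by (simp add: pos_divide_le_eq)
qed

section \<open>The logarithmic factors\<close>

lemma C_alpha_pos: "0 < \<alpha> \<Longrightarrow> \<alpha> < 1/2 \<Longrightarrow> 0 < C_alpha \<alpha>"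
  unfolding C_alpha_def by (intro mult_pos_pos ln_gt_zero) (auto simp: field_simps)

lemma exp_2_le_8: "exp 2 \<le> (8::real)"
proof -
  have "exp (2::real) = exp 1 * exp 1" by (simp flip: exp_add)
  also have "\<dots> \<le> 2.72 * 2.72" using e_less_272 by (intro mult_mono) auto
  finally show ?thesis by simp
qed

lemma ln_ge_2: "2 \<le> ln x" if "8 \<le> x" for x :: real
proof -
  have "ln (exp 2) \<le> ln x" using that exp_2_le_8 by (subst ln_le_cancel_iff) auto
  then show ?thesis by simp
qed

text \<open>For L \<ge> 2 the stated bound is weaker than the one without logarithm: 8 L \<ge> 16 in
  the numerator, and dividing by \<open>L\<close> only decreases it. In every other case the stated
  bound is nonpositive.\<close>

lemma mem_lower_bound_log:
  assumes lam: "0 < lam" "lam \<le> 1" and n: "1 \<le> n" and \<alpha>: "0 < \<alpha>" "\<alpha> < 1/2"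
    and A: "is_algorithm M A" and err: "err_alg d lam n A \<le> \<alpha>"
    and L: "0 < L \<Longrightarrow> 2 \<le> L"
  shows "1/128 * ((1 - 8 * lam\<^sup>2 * real n * L) / (lam ^ 4 * real n * L)) * C_alpha \<alpha> \<le> mem d lam n M A"
proof (cases "0 < L \<and> 0 < 1 - 8 * lam\<^sup>2 * real n * L")
  case True
  then have L2: "2 \<le> L" using L by blast
  define z where "z = lam\<^sup>2 * real n"
  have z: "0 < z" using lam n by (simp add: z_def)
  have "z * 2 \<le> z * L" using L2 z by simp
  moreover have zL: "0 < 1 - 8 * (z * L)" using True by (simp add: z_def mult.assoc)
  ultimately have z16: "16 * z \<le> 8 * (z * L)" "z \<le> 1/16" by linarith+
  have l0: "0 < lam ^ 4 * real n" using lam n by simp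
  have "(1 - 8 * (z * L)) / (lam ^ 4 * real n * L) \<le> (1 - 16 * z) / (lam ^ 4 * real n)"
  proof (rule frac_le)
    show "lam ^ 4 * real n \<le> lam ^ 4 * real n * L"
      using mult_left_mono[of 1 L "lam ^ 4 * real n"] l0 L2 by linarith
  qed (use z16 l0 in auto)
  then have "1/128 * ((1 - 8 * (z * L)) / (lam ^ 4 * real n * L)) * C_alpha \<alpha>
     \<le> 1/128 * ((1 - 16 * z) / (lam ^ 4 * real n)) * C_alpha \<alpha>"
    using C_alpha_pos[OF \<alpha>] by (intro mult_right_mono mult_left_mono) auto
  also have "\<dots> = C_alpha \<alpha> * (1 - 16 * z) / (128 * (lam ^ 4 * real n))" by simp
  also have "\<dots> \<le> mem d lam n M A" unfolding z_def
    using z16 by (intro mem_lower_bound lam n \<alpha> A err) (simp add: z_def)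
  finally show ?thesis by (simp add: z_def mult.assoc)
next
  case False
  have "(1 - 8 * lam\<^sup>2 * real n * L) / (lam ^ 4 * real n * L) \<le> 0"
  proof (cases "0 < L")
    case True
    then have "0 < lam ^ 4 * real n * L" using lam n by simp
    moreover have "1 - 8 * lam\<^sup>2 * real n * L \<le> 0" using False True by simp
    ultimately show ?thesis by (simp add: divide_nonpos_pos)
  next
    case L0: False
    then have "lam ^ 4 * real n * L \<le> 0" using lam n by (intro mult_nonneg_nonpos) auto
    have "8 * lam\<^sup>2 * real n * L \<le> 0" using lam n L0 by (intro mult_nonneg_nonpos) auto
    then have "0 \<le> 1 - 8 * lam\<^sup>2 * real n * L" by linarith
    then show ?thesis using \<open>lam ^ 4 * real n * L \<le> 0\<close> by (rule divide_nonneg_nonpos)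
  qed
  then have "1/128 * ((1 - 8 * lam\<^sup>2 * real n * L) / (lam ^ 4 * real n * L)) * C_alpha \<alpha> \<le> 0"
    using C_alpha_pos[OF \<alpha>] by (intro mult_nonpos_nonneg[OF mult_nonneg_nonpos]) auto
  then show ?thesis using mem_nonneg[of lam d n M A] lam by simp
qed

text \<open>From C \<le> 4 ln|M| and d n \<ge> 32 the argument of the logarithm is at least 8, which
  exceeds exp 2.\<close>

lemma log_factor_ge_2:
  assumes lam: "0 < lam" "lam \<le> 1" and n: "1 \<le> n" and \<alpha>: "0 < \<alpha>" "\<alpha> < 1/2" and d: "32 \<le> d"
    and A: "is_algorithm M A" and err: "err_alg d lam n A \<le> \<alpha>"
  shows "2 \<le> ln (real d * real n * ln (real (card M)) / C_alpha \<alpha>)"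
proof (rule ln_ge_2)
  have C: "C_alpha \<alpha> \<le> 4 * ln (real (card M))" using information_bounds[OF lam n \<alpha> A err] by blast
  have C0: "0 < C_alpha \<alpha>" by (rule C_alpha_pos[OF \<alpha>])
  then have "0 < ln (real (card M))" using C by simp
  have "32 * 1 \<le> real d * real n" using d n by (intro mult_mono) auto
  then have "32 * ln (real (card M)) \<le> real d * real n * ln (real (card M))"
    using \<open>0 < ln (real (card M))\<close> by (intro mult_right_mono) auto
  then have "8 * C_alpha \<alpha> \<le> real d * real n * ln (real (card M))" using C by linarith
  then show "8 \<le> real d * real n * ln (real (card M)) / C_alpha \<alpha>" using C0 by (simp add: pos_le_divide_eq)
qed

text \<open>Here C \<le> 8 lam^2 d ln 2 is used instead; with lam^2 n \<le> 1/64 it gives 8 C \<le>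
  d n.\<close>

lemma log_factor_small_sample_ge_2:
  assumes lam: "0 < lam" "lam \<le> 1" and n: "1 \<le> n" and x: "lam\<^sup>2 * real n \<le> 1/64" and \<alpha>: "0 < \<alpha>" "\<alpha> < 1/2"
    and A: "is_algorithm M A" and err: "err_alg d lam n A \<le> \<alpha>"
  shows "2 \<le> ln (real d * real n / C_alpha \<alpha>)"
proof (rule ln_ge_2)
  obtain I where C: "C_alpha \<alpha> \<le> 8 * lam\<^sup>2 * I" "I \<le> real d * ln 2"
    using information_bounds[OF lam n \<alpha> A err] by blast
  have C0: "0 < C_alpha \<alpha>" by (rule C_alpha_pos[OF \<alpha>])
  have "8 * lam\<^sup>2 * I \<le> 8 * lam\<^sup>2 * (real d * ln 2)" using C(2) by (intro mult_left_mono) auto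
  also have "\<dots> \<le> 8 * lam\<^sup>2 * (real d * 1)" using ln_2_less_1 by (intro mult_left_mono) auto
  finally have "8 * C_alpha \<alpha> \<le> 64 * lam\<^sup>2 * real d" using C(1) by linarith
  also have "\<dots> \<le> 64 * (lam\<^sup>2 * real n) * real d"
    using mult_left_mono[of 1 "real n" "64 * lam\<^sup>2 * real d"] n by (simp add: algebra_simps)
  also have "\<dots> \<le> 1 * real d" using x by (intro mult_right_mono) auto
  also have "\<dots> \<le> real d * real n" using mult_left_mono[of 1 "real n" "real d"] n by simp
  finally show "8 \<le> real d * real n / C_alpha \<alpha>" using C0 by (simp add: pos_le_divide_eq)
qed

section \<open>Moments of product measures\<close>

lemma sum_PiE_pair_prod:
  fixes w :: "nat \<Rightarrow> 'a \<Rightarrow> 'b \<Rightarrow> real"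
  assumes "finite A" "finite B"
  shows "(\<Sum>x\<in>PiE {0..<d} (\<lambda>_. A). \<Sum>y\<in>PiE {0..<d} (\<lambda>_. B). \<Prod>i<d. w i (x i) (y i))
    = (\<Prod>i<d. \<Sum>a\<in>A. \<Sum>b\<in>B. w i a b)"
proof -
  have "(\<Sum>y\<in>PiE {0..<d} (\<lambda>_. B). \<Prod>i<d. w i (x i) (y i)) = (\<Prod>i<d. \<Sum>b\<in>B. w i (x i) b)" for x
    by (rule sum_PiE_prod) (rule assms)
  then show ?thesis using sum_PiE_prod[OF assms(1), of "\<lambda>i a. \<Sum>b\<in>B. w i a b"] by simp
qed

text \<open>Spreads a factor at one coordinate over the whole product, so that sums over product
  sets factorize.\<close>

lemma prod_mult_single:
  fixes F G :: "nat \<Rightarrow> real"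
  assumes "k < d"
  shows "(\<Prod>i<d. F i * (if i = k then G i else 1)) = (\<Prod>i<d. F i) * G k"
  using assms by (simp add: prod.distrib prod.delta)

text \<open>Each summand touches one coordinate, and the weights of all other coordinates sum to 1.
  This makes mutual information additive over coordinates.\<close>

lemma first_moment_product:
  fixes w g :: "nat \<Rightarrow> 'a \<Rightarrow> 'b \<Rightarrow> real"
  assumes fin: "finite A" "finite B" and w1: "\<And>i. i < d \<Longrightarrow> (\<Sum>a\<in>A. \<Sum>b\<in>B. w i a b) = 1"
  shows "(\<Sum>x\<in>PiE {0..<d} (\<lambda>_. A). \<Sum>y\<in>PiE {0..<d} (\<lambda>_. B). (\<Prod>i<d. w i (x i) (y i)) * (\<Sum>i<d. g i (x i) (y i)))
    = (\<Sum>i<d. \<Sum>a\<in>A. \<Sum>b\<in>B. w i a b * g i a b)"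
proof -
  let ?X = "PiE {0..<d} (\<lambda>_. A)" and ?Y = "PiE {0..<d} (\<lambda>_. B)"
  have single: "(\<Sum>x\<in>?X. \<Sum>y\<in>?Y. (\<Prod>i<d. w i (x i) (y i)) * g k (x k) (y k)) = (\<Sum>a\<in>A. \<Sum>b\<in>B. w k a b * g k a b)"
    if k: "k < d" for k
  proof -
    have "(\<Sum>x\<in>?X. \<Sum>y\<in>?Y. (\<Prod>i<d. w i (x i) (y i)) * g k (x k) (y k))
       = (\<Sum>x\<in>?X. \<Sum>y\<in>?Y. \<Prod>i<d. w i (x i) (y i) * (if i = k then g i (x i) (y i) else 1))"
      using prod_mult_single[OF k] by simp
    also have "\<dots> = (\<Prod>i<d. \<Sum>a\<in>A. \<Sum>b\<in>B. w i a b * (if i = k then g i a b else 1))"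
      by (rule sum_PiE_pair_prod[OF fin])
    also have "\<dots> = (\<Prod>i<d. if i = k then (\<Sum>a\<in>A. \<Sum>b\<in>B. w i a b * g i a b) else 1)"
      by (intro prod.cong) (auto simp: w1)
    also have "\<dots> = (\<Sum>a\<in>A. \<Sum>b\<in>B. w k a b * g k a b)" using k by (simp add: prod.delta)
    finally show ?thesis .
  qed
  have "(\<Sum>x\<in>?X. \<Sum>y\<in>?Y. (\<Prod>i<d. w i (x i) (y i)) * (\<Sum>i<d. g i (x i) (y i)))
     = (\<Sum>k<d. \<Sum>x\<in>?X. \<Sum>y\<in>?Y. (\<Prod>i<d. w i (x i) (y i)) * g k (x k) (y k))"
    unfolding sum_distrib_left by (subst (2) sum.swap, subst sum.swap, rule refl)
  then show ?thesis by (simp add: single)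
qed

lemma second_moment_product:
  fixes w g :: "nat \<Rightarrow> 'a \<Rightarrow> 'b \<Rightarrow> real"
  assumes fin: "finite A" "finite B" and w1: "\<And>i. i < d \<Longrightarrow> (\<Sum>a\<in>A. \<Sum>b\<in>B. w i a b) = 1"
    and g0: "\<And>i. i < d \<Longrightarrow> (\<Sum>a\<in>A. \<Sum>b\<in>B. w i a b * g i a b) = 0"
  shows "(\<Sum>x\<in>PiE {0..<d} (\<lambda>_. A). \<Sum>y\<in>PiE {0..<d} (\<lambda>_. B). (\<Prod>i<d. w i (x i) (y i)) * (\<Sum>i<d. g i (x i) (y i))\<^sup>2)
    = (\<Sum>i<d. \<Sum>a\<in>A. \<Sum>b\<in>B. w i a b * (g i a b)\<^sup>2)"
proof -
  let ?X = "PiE {0..<d} (\<lambda>_. A)" and ?Y = "PiE {0..<d} (\<lambda>_. B)"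
  define E where "E k l = (\<Sum>x\<in>?X. \<Sum>y\<in>?Y. (\<Prod>i<d. w i (x i) (y i)) * (g k (x k) (y k) * g l (x l) (y l)))" for k l
  have E: "E k l = (if k = l then \<Sum>a\<in>A. \<Sum>b\<in>B. w k a b * (g k a b)\<^sup>2 else 0)" if k: "k < d" and l: "l < d" for k l
  proof -
    have "E k l = (\<Sum>x\<in>?X. \<Sum>y\<in>?Y. \<Prod>i<d. w i (x i) (y i) * (if i = k then g i (x i) (y i) else 1) * (if i = l then g i (x i) (y i) else 1))"
      using prod_mult_single[OF k] prod_mult_single[OF l] by (simp add: E_def mult.assoc[symmetric])
    also have "\<dots> = (\<Prod>i<d. \<Sum>a\<in>A. \<Sum>b\<in>B. w i a b * (if i = k then g i a b else 1) * (if i = l then g i a b else 1))"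
      by (rule sum_PiE_pair_prod[OF fin])
    also have "\<dots> = (if k = l then \<Sum>a\<in>A. \<Sum>b\<in>B. w k a b * (g k a b)\<^sup>2 else 0)"
    proof (cases "k = l")
      case True
      have "(\<Prod>i<d. \<Sum>a\<in>A. \<Sum>b\<in>B. w i a b * (if i = k then g i a b else 1) * (if i = l then g i a b else 1))
         = (\<Prod>i<d. if i = k then (\<Sum>a\<in>A. \<Sum>b\<in>B. w i a b * (g i a b)\<^sup>2) else 1)"
        by (intro prod.cong) (auto simp: w1 True power2_eq_square mult.assoc)
      then show ?thesis using k True by (simp add: prod.delta)
    next
      case False
      \<comment> \<open>Cross terms vanish: the factor at coordinate \<open>k\<close> is the mean of
        a centered variable.\<close>
      have "(\<Prod>i<d. \<Sum>a\<in>A. \<Sum>b\<in>B. w i a b * (if i = k then g i a b else 1) * (if i = l then g i a b else 1)) = 0"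
        using k False g0[OF k] by (intro prod_zero) (auto intro!: bexI[of _ k])
      then show ?thesis using False by simp
    qed
    finally show ?thesis .
  qed
  have "(\<Sum>x\<in>?X. \<Sum>y\<in>?Y. (\<Prod>i<d. w i (x i) (y i)) * (\<Sum>i<d. g i (x i) (y i))\<^sup>2)
     = (\<Sum>x\<in>?X. \<Sum>y\<in>?Y. \<Sum>k<d. \<Sum>l<d. (\<Prod>i<d. w i (x i) (y i)) * (g k (x k) (y k) * g l (x l) (y l)))"
    by (simp only: power2_eq_square sum_product) (simp only: sum_distrib_left)
  also have "\<dots> = (\<Sum>x\<in>?X. \<Sum>k<d. \<Sum>l<d. \<Sum>y\<in>?Y. (\<Prod>i<d. w i (x i) (y i)) * (g k (x k) (y k) * g l (x l) (y l)))"
    by (intro sum.cong refl, subst sum.swap, intro sum.cong refl, rule sum.swap)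
  also have "\<dots> = (\<Sum>k<d. \<Sum>l<d. E k l)"
    unfolding E_def by (subst sum.swap, intro sum.cong refl, rule sum.swap)
  also have "\<dots> = (\<Sum>k<d. \<Sum>l<d. if k = l then \<Sum>a\<in>A. \<Sum>b\<in>B. w k a b * (g k a b)\<^sup>2 else 0)"
    by (intro sum.cong) (auto simp: E)
  finally show ?thesis by (simp add: sum.delta')
qed

section \<open>Coordinatewise estimators\<close>

text \<open>Off the cube the classifier encodes \<open>z\<close>, so that distinct estimates give distinct classifiers.\<close>

definition corr_classifier :: "nat \<Rightarrow> real \<Rightarrow> (nat \<Rightarrow> int) \<Rightarrow> classifier" where
  "corr_classifier d lam z = (\<lambda>y. if y \<in> cube d then lam\<^sup>2 * real d / 4 \<le> (\<Sum>i<d. real_of_int (z i * y i))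
     else y = (\<lambda>i. 2 * z i))"

lemma inj_on_corr_classifier:
  assumes "0 < d"
  shows "inj_on (corr_classifier d lam) (cube d)"
proof (rule inj_onI)
  fix z z' assume z: "z \<in> cube d" and eq: "corr_classifier d lam z = corr_classifier d lam z'"
  \<comment> \<open>Doubling leaves the cube because entry 0 becomes 2 or -2, so the classifier
    reveals \<open>z\<close> at this point.\<close>
  have nc: "(\<lambda>i. 2 * z i) \<notin> cube d" using cubeD[OF z assms] cubeD[of "\<lambda>i. 2 * z i" d 0] assms by auto
  then have "corr_classifier d lam z (\<lambda>i. 2 * z i)" by (simp add: corr_classifier_def)
  then have "(\<lambda>i. 2 * z i) = (\<lambda>i. 2 * z' i)" unfolding eq using nc by (simp add: corr_classifier_def)
  then show "z = z'" by (auto simp: fun_eq_iff)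
qed

section \<open>Output law, memorization and error of a coordinatewise estimator\<close>

locale coordinate_kernel =
  fixes d n :: nat and lam :: real and k :: "(nat \<Rightarrow> int) \<Rightarrow> int pmf"
  assumes d: "0 < d" and lam: "0 < lam" "lam \<le> 1" and set_k: "\<And>c. set_pmf (k c) \<subseteq> {-1, 1}"
begin

text \<open>Every coordinate is estimated independently by the same kernel. The restriction turns
  the column into an element of \<open>signs n\<close>, as delivered by transposition.\<close>

definition estimate :: "(nat \<Rightarrow> nat \<Rightarrow> int) \<Rightarrow> (nat \<Rightarrow> int) pmf" where
  "estimate xs = Pi_pmf {0..<d} undefined (\<lambda>i. k (\<lambda>j\<in>{0..<n}. xs j i))"

definition alg :: algorithm where
  "alg xs = map_pmf (corr_classifier d lam) (estimate xs)"

definition out :: "int \<Rightarrow> int \<Rightarrow> real" where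
  "out s v = (\<Sum>c\<in>signs n. colw lam n s c * pmf (k c) v)"

lemma set_estimate: "set_pmf (estimate xs) \<subseteq> cube d"
  unfolding estimate_def cube_def PiE_dflt_undefined[symmetric]
  using set_k by (subst set_Pi_pmf) (auto simp: PiE_dflt_def subset_iff)

lemma is_algorithm_alg: "is_algorithm (corr_classifier d lam ` cube d) alg"
  using set_estimate by (auto simp: is_algorithm_def alg_def)

lemma pmf_alg:
  assumes z: "z \<in> cube d"
  shows "pmf (alg xs) (corr_classifier d lam z) = (\<Prod>i<d. pmf (k (\<lambda>j\<in>{0..<n}. xs j i)) (z i))"
proof -
  have "pmf (alg xs) (corr_classifier d lam z) = measure_pmf.prob (estimate xs) (corr_classifier d lam -` {corr_classifier d lam z})"
    by (simp add: alg_def pmf_map)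
  also have "\<dots> = measure_pmf.prob (estimate xs) {z}"
    by (rule measure_pmf.finite_measure_eq_AE)
       (use set_estimate[of xs] inj_onD[OF inj_on_corr_classifier[OF d, of lam], of _ z] z in \<open>auto simp: AE_measure_pmf_iff\<close>)
  also have "\<dots> = pmf (estimate xs) z" by (simp add: measure_pmf_single)
  also have "\<dots> = (\<Prod>i<d. pmf (k (\<lambda>j\<in>{0..<n}. xs j i)) (z i))"
    unfolding estimate_def using z
    by (subst pmf_Pi') (auto simp: cube_def PiE_iff extensional_def atLeast0LessThan)
  finally show ?thesis .
qed

lemma sum_k: "(\<Sum>v\<in>{-1, 1}. pmf (k c) v) = 1"
  by (rule sum_pmf_eq_1) (use set_k in auto)

lemma sum_colw: "s \<in> {-1, 1} \<Longrightarrow> (\<Sum>c\<in>signs n. colw lam n s c) = 1"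
  unfolding colw_def by (subst sum_PiE_prod) (simp_all only: sum_bw prod.neutral_const finite.intros)

lemma sum_out: "s \<in> {-1, 1} \<Longrightarrow> (\<Sum>v\<in>{-1, 1}. out s v) = 1"
  unfolding out_def by (subst sum.swap) (simp only: sum_distrib_left[symmetric] sum_k mult_1_right sum_colw)

lemma out_minus: "s \<in> {-1, 1} \<Longrightarrow> out s (-1) = 1 - out s 1"
  using sum_out[of s] by auto

lemma out_nonneg: "s \<in> {-1, 1} \<Longrightarrow> 0 \<le> out s v"
  unfolding out_def using lam by (intro sum_nonneg mult_nonneg_nonneg colw_nonneg) auto

lemma column_samples_of_columns:
  assumes "c \<in> PiE {0..<d} (\<lambda>_. signs n)" "i < d"
  shows "(\<lambda>j\<in>{0..<n}. samples_of_columns d n c j i) = c i"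
proof -
  have "c i \<in> extensional {0..<n}" using assms by (auto simp: PiE_iff)
  then show ?thesis using assms(2) by (auto simp: samples_of_columns_def fun_eq_iff extensional_def)
qed

text \<open>The free function \<open>F\<close> lets one change of variables serve both the output
  law and the entropy integrand.\<close>

lemma sum_samples_alg:
  assumes z: "z \<in> cube d"
  shows "(\<Sum>xs\<in>sample_space d n. smpw lam d n \<theta> xs * F (pmf (alg xs) (corr_classifier d lam z)))
    = (\<Sum>c\<in>PiE {0..<d} (\<lambda>_. signs n). (\<Prod>i<d. colw lam n (\<theta> i) (c i)) * F (\<Prod>i<d. pmf (k (c i)) (z i)))"
proof -
  have "(\<Prod>i<d. pmf (k (\<lambda>j\<in>{0..<n}. samples_of_columns d n c j i)) (z i)) = (\<Prod>i<d. pmf (k (c i)) (z i))"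
    if "c \<in> PiE {0..<d} (\<lambda>_. signs n)" for c
    by (intro prod.cong) (auto simp: column_samples_of_columns[OF that])
  then show ?thesis
    unfolding sum.reindex_bij_betw[OF bij_betw_samples_of_columns, symmetric] using z
    by (intro sum.cong refl) (simp add: pmf_alg smpw_samples_of_columns)
qed

lemma sum_samples_pmf_alg:
  assumes z: "z \<in> cube d"
  shows "(\<Sum>xs\<in>sample_space d n. smpw lam d n \<theta> xs * pmf (alg xs) (corr_classifier d lam z)) = (\<Prod>i<d. out (\<theta> i) (z i))"
proof -
  have "(\<Sum>xs\<in>sample_space d n. smpw lam d n \<theta> xs * pmf (alg xs) (corr_classifier d lam z))
     = (\<Sum>c\<in>PiE {0..<d} (\<lambda>_. signs n). (\<Prod>i<d. colw lam n (\<theta> i) (c i)) * (\<Prod>i<d. pmf (k (c i)) (z i)))"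
    by (rule sum_samples_alg[OF z, where F = "\<lambda>a. a"])
  also have "\<dots> = (\<Sum>c\<in>PiE {0..<d} (\<lambda>_. signs n). \<Prod>i<d. colw lam n (\<theta> i) (c i) * pmf (k (c i)) (z i))"
    by (simp add: prod.distrib)
  also have "\<dots> = (\<Prod>i<d. out (\<theta> i) (z i))"
    unfolding out_def by (rule sum_PiE_prod) (auto intro!: finite_PiE)
  finally show ?thesis .
qed

text \<open>The output probabilities and their averages both factor over coordinates, so the
  log-ratio is a sum and its expectation splits into one-column entropies.\<close>

lemma mi_given_alg:
  assumes \<theta>: "\<theta> \<in> cube d"
  shows "mi_given d lam n (corr_classifier d lam ` cube d) alg \<theta>
    = (\<Sum>i<d. \<Sum>v\<in>{-1, 1}. ent (signs n) (colw lam n (\<theta> i)) (\<lambda>c. pmf (k c) v))"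
proof -
  let ?C = "PiE {0..<d} (\<lambda>_. signs n)"
  define w where "w i v c = colw lam n (\<theta> i) c * pmf (k c) v" for i v c
  define g where "g i v c = ln (pmf (k c) v) - ln (out (\<theta> i) v)" for i v c
  have \<theta>i: "\<theta> i \<in> {-1, 1}" if "i < d" for i using cubeD[OF \<theta> that] .
  have pw: "(\<Prod>i<d. colw lam n (\<theta> i) (c i)) * ((\<Prod>i<d. pmf (k (c i)) (z i)) * (ln (\<Prod>i<d. pmf (k (c i)) (z i)) - ln (\<Prod>i<d. out (\<theta> i) (z i))))
      = (\<Prod>i<d. w i (z i) (c i)) * (\<Sum>i<d. g i (z i) (c i))" if c: "c \<in> ?C" for c z
  \<comment> \<open>The logarithm of a product is split only when the factors are positive; terms of
    zero weight vanish on both sides.\<close>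
  proof (cases "(\<Prod>i<d. w i (z i) (c i)) = 0")
    case True
    then have "(\<Prod>i<d. colw lam n (\<theta> i) (c i)) * (\<Prod>i<d. pmf (k (c i)) (z i)) = 0"
      unfolding w_def prod.distrib .
    then show ?thesis unfolding True by (simp only: mult.assoc[symmetric] mult_zero_left)
  next
    case False
    have nz: "w i (z i) (c i) \<noteq> 0" if "i < d" for i using False that by auto
    have ci: "c i \<in> signs n" if "i < d" for i using c that by (auto simp: PiE_iff)
    have a: "0 < pmf (k (c i)) (z i)" if "i < d" for i
      using nz[OF that] by (simp add: w_def less_le)
    have o: "0 < out (\<theta> i) (z i)" if i: "i < d" for i
    proof -
      have "0 < colw lam n (\<theta> i) (c i) * pmf (k (c i)) (z i)"
        using nz[OF i] colw_nonneg[of lam "\<theta> i" "c i" n] \<theta>i[OF i] ci[OF i] lam by (auto simp: w_def less_le)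
      also have "\<dots> \<le> out (\<theta> i) (z i)" unfolding out_def
        using ci[OF i] \<theta>i[OF i] lam by (intro member_le_sum) (auto intro!: mult_nonneg_nonneg colw_nonneg finite_PiE)
      finally show ?thesis .
    qed
    have "ln (\<Prod>i<d. pmf (k (c i)) (z i)) = (\<Sum>i<d. ln (pmf (k (c i)) (z i)))"
      by (intro ln_prod) (use a in \<open>force+\<close>)
    moreover have "ln (\<Prod>i<d. out (\<theta> i) (z i)) = (\<Sum>i<d. ln (out (\<theta> i) (z i)))"
      by (intro ln_prod) (use o in \<open>force+\<close>)
    ultimately show ?thesis by (simp add: w_def g_def prod.distrib sum_subtractf)
  qed
  have "mi_given d lam n (corr_classifier d lam ` cube d) alg \<theta>
     = (\<Sum>z\<in>cube d. ent (sample_space d n) (smpw lam d n \<theta>) (\<lambda>xs. pmf (alg xs) (corr_classifier d lam z)))"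
    using lam \<theta> by (simp add: mi_given_eq sum.reindex[OF inj_on_corr_classifier[OF d]])
  also have "\<dots> = (\<Sum>z\<in>cube d. \<Sum>c\<in>?C. (\<Prod>i<d. w i (z i) (c i)) * (\<Sum>i<d. g i (z i) (c i)))"
  proof (rule sum.cong[OF refl])
    fix z assume z: "z \<in> cube d"
    show "ent (sample_space d n) (smpw lam d n \<theta>) (\<lambda>xs. pmf (alg xs) (corr_classifier d lam z))
       = (\<Sum>c\<in>?C. (\<Prod>i<d. w i (z i) (c i)) * (\<Sum>i<d. g i (z i) (c i)))"
      unfolding ent_alt sum_samples_pmf_alg[OF z]
      by (subst sum_samples_alg[OF z, where F = "\<lambda>a. a * (ln a - ln (\<Prod>i<d. out (\<theta> i) (z i)))"])
         (rule sum.cong[OF refl], rule pw)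
  qed
  also have "\<dots> = (\<Sum>i<d. \<Sum>v\<in>{-1, 1}. \<Sum>c\<in>signs n. w i v c * g i v c)"
    unfolding cube_def
  proof (rule first_moment_product)
    show "(\<Sum>v\<in>{-1, 1}. \<Sum>c\<in>signs n. w i v c) = 1" if "i < d" for i
      using sum_out[OF \<theta>i[OF that]] unfolding out_def w_def .
  qed (auto intro!: finite_PiE)
  also have "\<dots> = (\<Sum>i<d. \<Sum>v\<in>{-1, 1}. ent (signs n) (colw lam n (\<theta> i)) (\<lambda>c. pmf (k c) v))"
    unfolding ent_alt w_def g_def out_def by (simp only: mult.assoc)
  finally show ?thesis .
qed

lemma mem_alg_le:
  assumes "\<And>s. s \<in> {-1, 1} \<Longrightarrow> (\<Sum>v\<in>{-1, 1}. ent (signs n) (colw lam n s) (\<lambda>c. pmf (k c) v)) \<le> b"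
  shows "mem d lam n (corr_classifier d lam ` cube d) alg \<le> real d * b"
proof -
  have "mi_given d lam n (corr_classifier d lam ` cube d) alg \<theta> \<le> real d * b" if \<theta>: "\<theta> \<in> cube d" for \<theta>
  proof -
    have "(\<Sum>i<d. \<Sum>v\<in>{-1, 1}. ent (signs n) (colw lam n (\<theta> i)) (\<lambda>c. pmf (k c) v)) \<le> (\<Sum>i<d. b)"
      by (intro sum_mono assms) (use cubeD[OF \<theta>] in auto)
    then show ?thesis unfolding mi_given_alg[OF \<theta>] by simp
  qed
  then have "mem d lam n (corr_classifier d lam ` cube d) alg \<le> (\<Sum>\<theta>\<in>cube d. 1 / 2 ^ d * (real d * b))"
    unfolding mem_def prior_def expectation_cube_uniform by (intro sum_mono mult_left_mono) auto
  then show ?thesis by (simp add: card_cube)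
qed

text \<open>Given \<theta>, the products of estimate and test coordinates are independent signs with
  means \<open>m i\<close>, hence variances 1 - (m i)^2 \<le> 1. The parameter \<open>l\<close>
  covers the planted law and, at 0, the null law.\<close>

lemma correlation_second_moment:
  assumes \<theta>: "\<theta> \<in> cube d" and l: "0 \<le> l" "l \<le> 1"
  defines "m \<equiv> \<lambda>i. l * (\<Sum>v\<in>{-1, 1}. out (\<theta> i) v * real_of_int (\<theta> i * v))"
  shows "(\<Sum>z\<in>cube d. \<Sum>y\<in>cube d. (\<Prod>i<d. out (\<theta> i) (z i)) * vecw l d \<theta> y * (\<Sum>i<d. real_of_int (z i * y i) - m i)\<^sup>2) \<le> real d"
proof -
  define w where "w i a b = out (\<theta> i) a * bw l (\<theta> i) b" for i a b
  define g where "g i a b = real_of_int (a * b) - m i" for i and a b :: int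
  have \<theta>i: "\<theta> i = 1 \<or> \<theta> i = -1" if "i < d" for i using cubeD[OF \<theta> that] by auto
  have "(\<Sum>z\<in>cube d. \<Sum>y\<in>cube d. (\<Prod>i<d. w i (z i) (y i)) * (\<Sum>i<d. g i (z i) (y i))\<^sup>2)
     = (\<Sum>i<d. \<Sum>a\<in>{-1, 1}. \<Sum>b\<in>{-1, 1}. w i a b * (g i a b)\<^sup>2)"
    unfolding cube_def
  proof (rule second_moment_product)
    fix i assume i: "i < d"
    show "(\<Sum>a\<in>{-1, 1}. \<Sum>b\<in>{-1, 1}. w i a b) = 1"
      using \<theta>i[OF i] by (auto simp: w_def bw_def out_minus field_simps)
    show "(\<Sum>a\<in>{-1, 1}. \<Sum>b\<in>{-1, 1}. w i a b * g i a b) = 0"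
      using \<theta>i[OF i] by (auto simp: w_def g_def m_def bw_def out_minus field_simps)
  qed auto
  also have "\<dots> \<le> (\<Sum>i<d. 1)"
  proof (rule sum_mono)
    fix i assume "i \<in> {..<d}"
    then have i: "i < d" by simp
    have "(\<Sum>a\<in>{-1, 1}. \<Sum>b\<in>{-1, 1}. w i a b * (g i a b)\<^sup>2) = 1 - (m i)\<^sup>2"
      using \<theta>i[OF i] by (auto simp: w_def g_def m_def bw_def out_minus field_simps power2_eq_square)
    then show "(\<Sum>a\<in>{-1, 1}. \<Sum>b\<in>{-1, 1}. w i a b * (g i a b)\<^sup>2) \<le> 1" by simp
  qed
  finally show ?thesis by (simp add: w_def g_def vecw_def prod.distrib)
qed

text \<open>The correlation has mean 0 under the null and at least lam^2 d / 2 = 2 \<tau> under the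
  planted law. Thresholding at \<tau> requires a deviation of at least \<tau> for an error, so
  Chebyshev with variance at most d bounds both errors by d / \<tau>^2.\<close>

lemma err_alg_le:
  assumes corr: "\<And>s. s \<in> {-1, 1} \<Longrightarrow> lam / 2 \<le> (\<Sum>v\<in>{-1, 1}. out s v * real_of_int (s * v))"
  shows "err_alg d lam n alg \<le> 16 / (lam ^ 4 * real d)"
proof -
  define \<tau> where "\<tau> = lam\<^sup>2 * real d / 4"
  have \<tau>: "0 < \<tau>" using lam d by (simp add: \<tau>_def)
  define S where "S z y = (\<Sum>i<d. real_of_int (z i * y i))" for z y :: "nat \<Rightarrow> int"
  have cheb: "(\<Sum>z\<in>cube d. \<Sum>y\<in>cube d. (\<Prod>i<d. out (\<theta> i) (z i)) * vecw l d \<theta> y * of_bool (Q z y)) \<le> real d / \<tau>\<^sup>2"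
    if \<theta>: "\<theta> \<in> cube d" and l: "0 \<le> l" "l \<le> 1"
      and Q: "\<And>z y. z \<in> cube d \<Longrightarrow> y \<in> cube d \<Longrightarrow> Q z y \<Longrightarrow>
        \<tau> \<le> \<bar>\<Sum>i<d. real_of_int (z i * y i) - l * (\<Sum>v\<in>{-1, 1}. out (\<theta> i) v * real_of_int (\<theta> i * v))\<bar>" for \<theta> l Q
  proof -
    define D where "D z y = (\<Sum>i<d. real_of_int (z i * y i) - l * (\<Sum>v\<in>{-1, 1}. out (\<theta> i) v * real_of_int (\<theta> i * v)))" for z y :: "nat \<Rightarrow> int"
    have "(\<Sum>z\<in>cube d. \<Sum>y\<in>cube d. (\<Prod>i<d. out (\<theta> i) (z i)) * vecw l d \<theta> y * of_bool (Q z y))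
       \<le> (\<Sum>z\<in>cube d. \<Sum>y\<in>cube d. (\<Prod>i<d. out (\<theta> i) (z i)) * vecw l d \<theta> y * ((D z y)\<^sup>2 / \<tau>\<^sup>2))"
    proof (intro sum_mono mult_left_mono)
      fix z y assume zy: "z \<in> cube d" "y \<in> cube d"
      show "of_bool (Q z y) \<le> (D z y)\<^sup>2 / \<tau>\<^sup>2"
      proof (cases "Q z y")
        case True
        then have "\<tau>\<^sup>2 \<le> \<bar>D z y\<bar>\<^sup>2" using Q[OF zy] \<tau> unfolding D_def by (intro power_mono) auto
        then show ?thesis using True \<tau> by simp
      qed simp
      show "0 \<le> (\<Prod>i<d. out (\<theta> i) (z i)) * vecw l d \<theta> y"
        using zy \<theta> l by (intro mult_nonneg_nonneg prod_nonneg vecw_nonneg) (auto intro!: out_nonneg dest: cubeD)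
    qed
    also have "\<dots> = (\<Sum>z\<in>cube d. \<Sum>y\<in>cube d. (\<Prod>i<d. out (\<theta> i) (z i)) * vecw l d \<theta> y * (D z y)\<^sup>2) / \<tau>\<^sup>2"
      by (simp add: sum_divide_distrib)
    also have "\<dots> \<le> real d / \<tau>\<^sup>2"
      using correlation_second_moment[OF \<theta> l] unfolding D_def by (intro divide_right_mono) auto
    finally show ?thesis .
  qed
  have v0: "vecw 0 d \<theta> y = 1 / 2 ^ d" for \<theta> y by (simp add: vecw_def bw_def power_one_over)
  have cls: "corr_classifier d lam z y = (\<tau> \<le> S z y)" if "y \<in> cube d" for z y
    using that by (simp add: corr_classifier_def \<tau>_def S_def)
  have one: "(\<Sum>h\<in>corr_classifier d lam ` cube d. (\<Sum>xs\<in>sample_space d n. smpw lam d n \<theta> xs * pmf (alg xs) h) *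
      (1/2 * (\<Sum>y\<in>cube d. vecw lam d \<theta> y * of_bool (\<not> h y)) + 1/2 * (\<Sum>y\<in>cube d. 1 / 2 ^ d * of_bool (h y)))) \<le> real d / \<tau>\<^sup>2"
    if \<theta>: "\<theta> \<in> cube d" for \<theta>
  proof -
    have "(\<Sum>h\<in>corr_classifier d lam ` cube d. (\<Sum>xs\<in>sample_space d n. smpw lam d n \<theta> xs * pmf (alg xs) h) *
      (1/2 * (\<Sum>y\<in>cube d. vecw lam d \<theta> y * of_bool (\<not> h y)) + 1/2 * (\<Sum>y\<in>cube d. 1 / 2 ^ d * of_bool (h y))))
      = (\<Sum>z\<in>cube d. (\<Prod>i<d. out (\<theta> i) (z i)) *
      (1/2 * (\<Sum>y\<in>cube d. vecw lam d \<theta> y * of_bool (\<not> \<tau> \<le> S z y)) + 1/2 * (\<Sum>y\<in>cube d. vecw 0 d \<theta> y * of_bool (\<tau> \<le> S z y))))"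
      by (simp only: sum.reindex[OF inj_on_corr_classifier[OF d]] o_def sum_samples_pmf_alg cls v0 cong: sum.cong)
    also have "\<dots> = 1/2 * (\<Sum>z\<in>cube d. \<Sum>y\<in>cube d. (\<Prod>i<d. out (\<theta> i) (z i)) * vecw lam d \<theta> y * of_bool (\<not> \<tau> \<le> S z y))
       + 1/2 * (\<Sum>z\<in>cube d. \<Sum>y\<in>cube d. (\<Prod>i<d. out (\<theta> i) (z i)) * vecw 0 d \<theta> y * of_bool (\<tau> \<le> S z y))"
      by (simp only: sum_distrib_left distrib_left sum.distrib mult.assoc mult.left_commute)
    also have "\<dots> \<le> 1/2 * (real d / \<tau>\<^sup>2) + 1/2 * (real d / \<tau>\<^sup>2)"
    proof (intro add_mono mult_left_mono cheb \<theta>)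
      fix z y assume "\<not> \<tau> \<le> S z y"
      have "(\<Sum>i<d. lam * (lam / 2)) \<le> (\<Sum>i<d. lam * (\<Sum>v\<in>{-1, 1}. out (\<theta> i) v * real_of_int (\<theta> i * v)))"
        using lam by (intro sum_mono mult_left_mono corr) (use cubeD[OF \<theta>] in auto)
      then have "2 * \<tau> \<le> (\<Sum>i<d. lam * (\<Sum>v\<in>{-1, 1}. out (\<theta> i) v * real_of_int (\<theta> i * v)))"
        by (simp add: \<tau>_def power2_eq_square algebra_simps)
      then show "\<tau> \<le> \<bar>\<Sum>i<d. real_of_int (z i * y i) - lam * (\<Sum>v\<in>{-1, 1}. out (\<theta> i) v * real_of_int (\<theta> i * v))\<bar>"
        using \<open>\<not> \<tau> \<le> S z y\<close> unfolding sum_subtractf S_def by linarith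
    next
      fix z y assume "\<tau> \<le> S z y"
      then show "\<tau> \<le> \<bar>\<Sum>i<d. real_of_int (z i * y i) - 0 * (\<Sum>v\<in>{-1, 1}. out (\<theta> i) v * real_of_int (\<theta> i * v))\<bar>"
        by (simp add: S_def)
    qed (use lam in auto)
    finally show ?thesis by simp
  qed
  have "err_alg d lam n alg \<le> (\<Sum>\<theta>\<in>cube d. 1 / 2 ^ d * (real d / \<tau>\<^sup>2))"
    unfolding err_alg_eq[OF less_imp_le[OF lam(1)] lam(2) is_algorithm_alg]
    by (intro sum_mono mult_left_mono one) auto
  also have "\<dots> = real d / \<tau>\<^sup>2" by (simp add: card_cube)
  also have "\<dots> = 16 / (lam ^ 4 * real d)"
    using lam d by (simp add: \<tau>_def power2_eq_square power4_eq_xxxx field_simps)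
  finally show ?thesis .
qed

end

section \<open>Random and majority votes\<close>

text \<open>The conditional forces a sign even for columns outside \<open>signs n\<close>, as the
  kernel locale asks of every argument.\<close>

definition random_vote :: "nat \<Rightarrow> (nat \<Rightarrow> int) \<Rightarrow> int pmf" where
  "random_vote n c = map_pmf (\<lambda>j. if c j = 1 then 1 else -1) (pmf_of_set {0..<n})"

definition majority_vote :: "nat \<Rightarrow> (nat \<Rightarrow> int) \<Rightarrow> int pmf" where
  "majority_vote n c = return_pmf (if 0 \<le> (\<Sum>j<n. c j) then 1 else -1)"

lemma pmf_random_vote:
  assumes n: "1 \<le> n" and c: "c \<in> signs n" and v: "v \<in> {-1, 1}"
  shows "pmf (random_vote n c) v = (\<Sum>j<n. of_bool (c j = v)) / real n"
proof -
  have ne: "{0..<n} \<noteq> {}" using n by auto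
  have eq: "((if c j = 1 then 1 else -1) = v) = (c j = v)" if "j < n" for j
  proof -
    have "c j \<in> {-1, 1}" using c that by (auto simp: PiE_iff)
    then show ?thesis using v by auto
  qed
  have "pmf (random_vote n c) v = measure_pmf.prob (pmf_of_set {0..<n}) {j. (if c j = 1 then 1 else -1) = v}"
    by (simp add: random_vote_def pmf_map vimage_def)
  also have "\<dots> = real (card ({0..<n} \<inter> {j. (if c j = 1 then 1 else -1) = v})) / real n"
    using ne by (subst measure_pmf_of_set) auto
  also have "{0..<n} \<inter> {j. (if c j = 1 then 1 else -1) = v} = {..<n} \<inter> {j. c j = v}"
    using eq by (intro set_eqI) (simp only: Int_iff mem_Collect_eq atLeastLessThan_iff lessThan_iff, blast)
  finally show ?thesis by (simp add: of_bool_def sum.If_cases)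
qed

lemma sum_colw_pair:
  assumes j: "j < n" and l: "l < n" and s: "s \<in> {-1, 1}" and v: "v \<in> {-1, 1}"
  shows "(\<Sum>c\<in>signs n. colw lam n s c * (of_bool (c j = v) * of_bool (c l = v)))
    = (if j = l then bw lam s v else (bw lam s v)\<^sup>2)"
proof -
  define g where "g a = (of_bool (a = v) :: real)" for a
  have gg: "g a * g a = g a" for a by (simp add: g_def)
  have sg: "(\<Sum>a\<in>{-1, 1}. bw lam s a * g a) = bw lam s v" using v by (auto simp: g_def)
  have "(\<Sum>c\<in>signs n. colw lam n s c * (g (c j) * g (c l)))
     = (\<Sum>c\<in>signs n. \<Prod>i<n. bw lam s (c i) * (if i = j then g (c i) else 1) * (if i = l then g (c i) else 1))"
    using prod_mult_single[OF j] prod_mult_single[OF l] by (simp add: colw_def mult.assoc[symmetric])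
  also have "\<dots> = (\<Prod>i<n. \<Sum>a\<in>{-1, 1}. bw lam s a * (if i = j then g a else 1) * (if i = l then g a else 1))"
    by (rule sum_PiE_prod) simp
  \<comment> \<open>The guard \<open>j \<noteq> l\<close> prevents counting the factor twice when
    both indices coincide, as an indicator is its own square.\<close>
  also have "\<dots> = (\<Prod>i<n. 1 * (if i = j then bw lam s v else 1) * (if i = l \<and> j \<noteq> l then bw lam s v else 1))"
  proof (intro prod.cong refl)
    fix i
    show "(\<Sum>a\<in>{-1, 1}. bw lam s a * (if i = j then g a else 1) * (if i = l then g a else 1))
       = 1 * (if i = j then bw lam s v else 1) * (if i = l \<and> j \<noteq> l then bw lam s v else 1)"
      using sg sum_bw[OF s, of lam] by (cases "i = j"; cases "i = l"; cases "j = l") (simp_all only: if_True if_False mult_1_right mult_1_left gg mult.assoc simp_thms)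
  qed
  also have "\<dots> = (if j = l then bw lam s v else (bw lam s v)\<^sup>2)"
    using j l by (simp add: prod.distrib prod.delta power2_eq_square)
  finally show ?thesis by (simp add: g_def)
qed

lemma sum_colw_single:
  assumes "j < n" "s \<in> {-1, 1}" "v \<in> {-1, 1}"
  shows "(\<Sum>c\<in>signs n. colw lam n s c * of_bool (c j = v)) = bw lam s v"
  using sum_colw_pair[OF assms(1,1,2,3), of lam] by (simp flip: of_bool_conj)

lemma sum_colw_random_vote:
  assumes n: "1 \<le> n" and s: "s \<in> {-1, 1}" and v: "v \<in> {-1, 1}"
  shows "(\<Sum>c\<in>signs n. colw lam n s c * pmf (random_vote n c) v) = bw lam s v"
proof -
  have "(\<Sum>c\<in>signs n. colw lam n s c * pmf (random_vote n c) v)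
     = (\<Sum>c\<in>signs n. \<Sum>j<n. colw lam n s c * of_bool (c j = v)) / real n"
    unfolding sum_divide_distrib[of _ "signs n"] by (intro sum.cong refl) (simp only: pmf_random_vote[OF n _ v] sum_distrib_left times_divide_eq_right)
  also have "\<dots> = (\<Sum>j<n. bw lam s v) / real n"
    by (subst sum.swap) (intro arg_cong2[where f = "(/)"] sum.cong refl sum_colw_single s v, auto)
  finally show ?thesis using n by simp
qed

text \<open>In the double sum over pairs of samples the diagonal contributes \<open>q / n\<close>
  and the off-diagonal part at most q^2.\<close>

lemma sum_colw_random_vote_square:
  assumes lam: "0 \<le> lam" "lam \<le> 1" and n: "1 \<le> n" and s: "s \<in> {-1, 1}" and v: "v \<in> {-1, 1}"
  shows "(\<Sum>c\<in>signs n. colw lam n s c * (pmf (random_vote n c) v)\<^sup>2) \<le> (bw lam s v)\<^sup>2 + bw lam s v / real n"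
proof -
  define q where "q = bw lam s v"
  have q: "0 \<le> q" unfolding q_def using lam s v by (intro bw_nonneg) auto
  have "(\<Sum>c\<in>signs n. colw lam n s c * (pmf (random_vote n c) v)\<^sup>2)
     = (\<Sum>c\<in>signs n. \<Sum>j<n. \<Sum>l<n. colw lam n s c * (of_bool (c j = v) * of_bool (c l = v))) / (real n)\<^sup>2"
    unfolding sum_divide_distrib[of _ "signs n"]
  proof (intro sum.cong refl)
    fix c assume c: "c \<in> signs n"
    have "(\<Sum>j<n. of_bool (c j = v))\<^sup>2 = (\<Sum>j<n. \<Sum>l<n. of_bool (c j = v) * of_bool (c l = v) :: real)"
      by (simp only: power2_eq_square sum_product)
    then show "colw lam n s c * (pmf (random_vote n c) v)\<^sup>2
       = (\<Sum>j<n. \<Sum>l<n. colw lam n s c * (of_bool (c j = v) * of_bool (c l = v))) / (real n)\<^sup>2"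
      by (simp only: pmf_random_vote[OF n c v] power_divide sum_distrib_left[symmetric] times_divide_eq_right)
  qed
  also have "(\<Sum>c\<in>signs n. \<Sum>j<n. \<Sum>l<n. colw lam n s c * (of_bool (c j = v) * of_bool (c l = v)))
     = (\<Sum>j<n. \<Sum>l<n. \<Sum>c\<in>signs n. colw lam n s c * (of_bool (c j = v) * of_bool (c l = v)))"
    by (subst sum.swap, intro sum.cong refl, rule sum.swap)
  also have "\<dots> = (\<Sum>j<n. \<Sum>l<n. if j = l then q else q\<^sup>2)"
    by (intro sum.cong refl) (simp only: sum_colw_pair s v lessThan_iff q_def)
  also have "\<dots> \<le> (\<Sum>j<n. \<Sum>l<n. (if j = l then q else 0) + q\<^sup>2)"
    by (intro sum_mono) auto
  also have "\<dots> = real n * q + (real n)\<^sup>2 * q\<^sup>2"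
    by (simp add: sum.distrib sum.delta' power2_eq_square algebra_simps)
  finally have "(\<Sum>c\<in>signs n. colw lam n s c * (pmf (random_vote n c) v)\<^sup>2) \<le> (real n * q + (real n)\<^sup>2 * q\<^sup>2) / (real n)\<^sup>2"
    by (simp add: divide_right_mono)
  also have "\<dots> = q\<^sup>2 + q / real n" using n by (simp add: field_simps power2_eq_square)
  finally show ?thesis by (simp add: q_def)
qed

text \<open>Linearizing \<open>ln\<close> at the mean \<open>q\<close> bounds the entropy by the
  variance of the empirical frequency divided by \<open>q\<close>, and that variance is at most
  \<open>q / n\<close>.\<close>

lemma ent_random_vote_le:
  assumes lam: "0 \<le> lam" "lam \<le> 1" and n: "1 \<le> n" and s: "s \<in> {-1, 1}" and v: "v \<in> {-1, 1}"
  shows "ent (signs n) (colw lam n s) (\<lambda>c. pmf (random_vote n c) v) \<le> 1 / real n"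
proof -
  define q where "q = bw lam s v"
  have q0: "0 \<le> q" unfolding q_def using lam s v by (intro bw_nonneg) auto
  define a where "a c = pmf (random_vote n c) v" for c
  have w: "0 \<le> colw lam n s c" if "c \<in> signs n" for c using lam s that by (intro colw_nonneg) auto
  have mean: "(\<Sum>c\<in>signs n. colw lam n s c * a c) = q"
    unfolding a_def q_def by (rule sum_colw_random_vote[OF n s v])
  have ent: "ent (signs n) (colw lam n s) a = (\<Sum>c\<in>signs n. colw lam n s c * (a c * (ln (a c) - ln q)))"
    unfolding ent_alt mean ..
  show ?thesis
  proof (cases "q = 0")
    case True
    have "colw lam n s c * a c = 0" if "c \<in> signs n" for c
      using mean that w unfolding True
      by (subst (asm) sum_nonneg_eq_0_iff) (auto simp: a_def intro!: finite_PiE)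
    then have "ent (signs n) (colw lam n s) a = 0"
      unfolding ent by (intro sum.neutral) auto
    then show ?thesis by (simp add: a_def[abs_def])
  next
    case False
    then have q: "0 < q" using q0 by simp
    have pw: "a c * (ln (a c) - ln q) \<le> a c * (a c / q - 1)" for c
    proof (cases "a c = 0")
      case False
      then have ac: "0 < a c" by (simp add: a_def less_le)
      then have "ln (a c / q) \<le> a c / q - 1" using q by (intro ln_le_minus_one) auto
      then show ?thesis using ac q by (intro mult_left_mono) (auto simp: ln_div)
    qed simp
    have "ent (signs n) (colw lam n s) a \<le> (\<Sum>c\<in>signs n. colw lam n s c * (a c * (a c / q - 1)))"
      unfolding ent by (intro sum_mono mult_left_mono pw w)
    also have "\<dots> = (\<Sum>c\<in>signs n. colw lam n s c * (a c)\<^sup>2) / q - (\<Sum>c\<in>signs n. colw lam n s c * a c)"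
      by (simp add: sum_divide_distrib sum_subtractf[symmetric] power2_eq_square algebra_simps)
    also have "\<dots> \<le> (q\<^sup>2 + q / real n) / q - q"
      unfolding mean using sum_colw_random_vote_square[OF lam n s v] q
      by (simp add: a_def q_def divide_right_mono)
    also have "\<dots> = 1 / real n" using q n by (simp add: field_simps power2_eq_square)
    finally show ?thesis by (simp add: a_def[abs_def])
  qed
qed

lemma coordinate_kernel_random_vote:
  "0 < d \<Longrightarrow> 0 < lam \<Longrightarrow> lam \<le> 1 \<Longrightarrow> coordinate_kernel d lam (random_vote n)"
  by unfold_locales (auto simp: random_vote_def)

lemma coordinate_kernel_majority_vote:
  "0 < d \<Longrightarrow> 0 < lam \<Longrightarrow> lam \<le> 1 \<Longrightarrow> coordinate_kernel d lam (majority_vote n)"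
  by unfold_locales (auto simp: majority_vote_def)

text \<open>Each estimated coordinate has the law of a fresh observation, so its correlation with
  \<theta> is exactly \<open>lam\<close>. The factor 2 counts the two output values.\<close>

lemma random_vote_algorithm:
  assumes d: "0 < d" and lam: "0 < lam" "lam \<le> 1" and n: "1 \<le> n"
  obtains M A where "is_algorithm M A" "err_alg d lam n A \<le> 16 / (lam ^ 4 * real d)" "mem d lam n M A \<le> 2 * real d / real n"
proof -
  interpret coordinate_kernel d n lam "random_vote n" by (rule coordinate_kernel_random_vote[OF d lam])
  have out: "out s v = bw lam s v" if "s \<in> {-1, 1}" "v \<in> {-1, 1}" for s v
    unfolding out_def using sum_colw_random_vote[OF n that] .
  have "mem d lam n (corr_classifier d lam ` cube d) alg \<le> real d * (2 / real n)"
  proof (rule mem_alg_le)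
    fix s :: int assume s: "s \<in> {-1, 1}"
    have "(\<Sum>v\<in>{-1, 1::int}. ent (signs n) (colw lam n s) (\<lambda>c. pmf (random_vote n c) v)) \<le> (\<Sum>v\<in>{-1, 1::int}. 1 / real n)"
      using lam n s by (intro sum_mono ent_random_vote_le) auto
    then show "(\<Sum>v\<in>{-1, 1::int}. ent (signs n) (colw lam n s) (\<lambda>c. pmf (random_vote n c) v)) \<le> 2 / real n" by simp
  qed
  moreover have "err_alg d lam n alg \<le> 16 / (lam ^ 4 * real d)"
  proof (rule err_alg_le)
    fix s :: int assume s: "s \<in> {-1, 1}"
    then have "(\<Sum>v\<in>{-1, 1}. out s v * real_of_int (s * v)) = lam" by (auto simp: out bw_def field_simps)
    then show "lam / 2 \<le> (\<Sum>v\<in>{-1, 1}. out s v * real_of_int (s * v))" using lam by simp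
  qed
  ultimately show thesis using that[OF is_algorithm_alg] by (simp add: mult.commute)
qed

text \<open>Chernoff bound with exponent lam/2: an erroneous vote, ties included, makes the
  exponential at least 1, and its one-sample mean is at most 1 - lam^2/4.\<close>

lemma majority_error_le:
  assumes lam: "0 < lam" "lam \<le> 1" and s: "s \<in> {-1, 1}"
  shows "(\<Sum>c\<in>signs n. colw lam n s c * pmf (majority_vote n c) (- s)) \<le> exp (- (lam\<^sup>2 * real n / 4))"
proof -
  have "(\<Sum>c\<in>signs n. colw lam n s c * pmf (majority_vote n c) (- s))
     \<le> (\<Sum>c\<in>signs n. colw lam n s c * exp (- real_of_int s * (lam / 2) * real_of_int (\<Sum>j<n. c j)))"
  proof (intro sum_mono mult_left_mono)
    fix c assume "c \<in> signs n"
    show "pmf (majority_vote n c) (- s) \<le> exp (- real_of_int s * (lam / 2) * real_of_int (\<Sum>j<n. c j))"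
    proof (cases "0 \<le> (\<Sum>j<n. c j)")
      case True
      then have "0 \<le> real_of_int (\<Sum>j<n. c j)" by (simp only: of_int_0_le_iff)
      then show ?thesis using s lam True by (auto simp: majority_vote_def)
    next
      case False
      then have "real_of_int (\<Sum>j<n. c j) \<le> 0" by (simp only: of_int_le_0_iff)
      then have "lam * real_of_int (\<Sum>j<n. c j) \<le> 0" using lam by (intro mult_nonneg_nonpos) auto
      then show ?thesis using s lam False by (auto simp: majority_vote_def)
    qed
    show "0 \<le> colw lam n s c" using \<open>c \<in> signs n\<close> lam s by (intro colw_nonneg) auto
  qed
  also have "\<dots> = (cosh (lam / 2) - lam * sinh (lam / 2)) ^ n"
    using s by (subst sum_colw_exp[OF s]) auto
  also have "\<dots> \<le> exp (- (lam\<^sup>2 / 4)) ^ n"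
  proof (rule power_mono)
    define y where "y = (lam / 2)\<^sup>2 / 2"
    have l2: "lam\<^sup>2 \<le> 1" using lam by (simp add: power_le_one)
    \<comment> \<open>For such small \<open>y\<close> the second-order bound on \<open>exp y\<close>
      is at most 1 + 2 y, which equals 1 + lam^2/4.\<close>
    have y: "0 \<le> y" "y \<le> 1/8" using l2 by (auto simp: y_def power_divide)
    have "cosh (lam / 2) \<le> exp y" unfolding y_def by (rule cosh_le_exp_half_square)
    also have "\<dots> \<le> 1 + y + y\<^sup>2" using y by (intro exp_bound) auto
    also have "\<dots> \<le> 1 + y + y * 1" using y unfolding power2_eq_square by (intro add_mono mult_left_mono) auto
    also have "\<dots> = 1 + lam\<^sup>2 / 4" by (simp add: y_def power_divide)
    finally have c: "cosh (lam / 2) \<le> 1 + lam\<^sup>2 / 4" .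
    have "lam * (lam / 2) \<le> lam * sinh (lam / 2)" using lam by (intro mult_left_mono sinh_ge_self) auto
    then have sh: "lam\<^sup>2 / 2 \<le> lam * sinh (lam / 2)" by (simp add: power2_eq_square)
    have "cosh (lam / 2) - lam * sinh (lam / 2) \<le> 1 + - (lam\<^sup>2 / 4)" using c sh by simp
    also have "\<dots> \<le> exp (- (lam\<^sup>2 / 4))" by (rule exp_ge_add_one_self)
    finally show "cosh (lam / 2) - lam * sinh (lam / 2) \<le> exp (- (lam\<^sup>2 / 4))" .
    have "lam * sinh (lam / 2) \<le> 1 * cosh (lam / 2)" using lam sinh_le_cosh_real[of "lam / 2"]
      by (intro mult_mono) auto
    then show "0 \<le> cosh (lam / 2) - lam * sinh (lam / 2)" by simp
  qed
  also have "\<dots> = exp (- (lam\<^sup>2 * real n / 4))" by (simp add: exp_of_nat_mult[symmetric] algebra_simps)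
  finally show ?thesis .
qed

text \<open>Comparing \<open>p\<close> with \<open>sqrt p\<close> works because ln p - ln (sqrt p)
  is half of ln p. The square root later halves the exponent of the majority error.\<close>

lemma binary_entropy_le:
  fixes p :: real
  assumes "0 \<le> p" "p \<le> 1"
  shows "- (p * ln p) - (1 - p) * ln (1 - p) \<le> 2 * sqrt p"
proof -
  have "(1 - p) - 1 \<le> (1 - p) * (ln (1 - p) - ln 1)" using assms by (intro mult_ln_diff_ge) auto
  then have 1: "- ((1 - p) * ln (1 - p)) \<le> p" by simp
  have 2: "- (p * ln p) \<le> 2 * sqrt p - 2 * p"
  proof (cases "p = 0")
    case False
    have "p - sqrt p \<le> p * (ln p - ln (sqrt p))" using assms False by (intro mult_ln_diff_ge) auto
    then show ?thesis using assms False by (simp add: ln_sqrt algebra_simps)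
  qed simp
  show ?thesis using 1 2 assms by simp
qed

lemma majority_vote_algorithm:
  assumes d: "0 < d" and lam: "0 < lam" "lam \<le> 1" and n: "8 \<le> lam\<^sup>2 * real n"
  obtains M A where "is_algorithm M A" "err_alg d lam n A \<le> 16 / (lam ^ 4 * real d)"
    "mem d lam n M A \<le> 2 * real d * exp (- (lam\<^sup>2 * real n / 8))"
proof -
  interpret coordinate_kernel d n lam "majority_vote n" by (rule coordinate_kernel_majority_vote[OF d lam])
  have p: "0 \<le> out s (- s)" "out s (- s) \<le> exp (- (lam\<^sup>2 * real n / 4))" "out s s = 1 - out s (- s)"
    if s: "s \<in> {-1, 1}" for s
    using out_nonneg[OF s] majority_error_le[OF lam s, of n] sum_out[OF s] s by (auto simp: out_def)
  have "mem d lam n (corr_classifier d lam ` cube d) alg \<le> real d * (2 * exp (- (lam\<^sup>2 * real n / 8)))"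
  proof (rule mem_alg_le)
    fix s :: int assume s: "s \<in> {-1, 1}"
    define q where "q = out s (- s)"
    \<comment> \<open>The vote is deterministic given its column, so the information equals the
      binary entropy of the error probability.\<close>
    have "pmf (majority_vote n c) v * ln (pmf (majority_vote n c) v) = 0" for c v
      by (auto simp: majority_vote_def indicator_def)
    then have "ent (signs n) (colw lam n s) (\<lambda>c. pmf (majority_vote n c) v) = - (out s v * ln (out s v))" for v
      unfolding ent_def out_def[symmetric] by (simp only: mult_zero_right sum.neutral_const diff_0)
    then have "(\<Sum>v\<in>{-1, 1::int}. ent (signs n) (colw lam n s) (\<lambda>c. pmf (majority_vote n c) v))
       = (\<Sum>v\<in>{-1, 1::int}. - (out s v * ln (out s v)))" by simp
    also have "\<dots> = - (q * ln q) - (1 - q) * ln (1 - q)"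
      using s p(3)[OF s] by (auto simp: q_def)
    also have "\<dots> \<le> 2 * sqrt q"
    proof (rule binary_entropy_le)
      show "0 \<le> q" using p(1)[OF s] by (simp add: q_def)
      have "q \<le> exp (- (lam\<^sup>2 * real n / 4))" using p(2)[OF s] by (simp add: q_def)
      also have "\<dots> \<le> 1" by simp
      finally show "q \<le> 1" .
    qed
    also have "sqrt q \<le> sqrt (exp (- (lam\<^sup>2 * real n / 4)))" using p(2)[OF s] by (simp add: q_def)
    also have "sqrt (exp (- (lam\<^sup>2 * real n / 4))) = exp (- (lam\<^sup>2 * real n / 8))"
      by (rule real_sqrt_unique) (simp_all add: power2_eq_square exp_add[symmetric])
    finally show "(\<Sum>v\<in>{-1, 1::int}. ent (signs n) (colw lam n s) (\<lambda>c. pmf (majority_vote n c) v))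
       \<le> 2 * exp (- (lam\<^sup>2 * real n / 8))" by simp
  qed
  moreover have "err_alg d lam n alg \<le> 16 / (lam ^ 4 * real d)"
  proof (rule err_alg_le)
    fix s :: int assume s: "s \<in> {-1, 1}"
    have "exp (- (lam\<^sup>2 * real n / 4)) \<le> exp (- 2)" using n by simp
    also have "\<dots> \<le> (1/4 :: real)"
    proof -
      have "2 * 2 \<le> exp 1 * exp (1::real)" using exp_ge_add_one_self[of "1::real"] by (intro mult_mono) auto
      then show ?thesis by (simp add: exp_minus field_simps flip: exp_add)
    qed
    finally have "out s (- s) \<le> 1/4" using p(2)[OF s] by simp
    moreover have "(\<Sum>v\<in>{-1, 1}. out s v * real_of_int (s * v)) = 1 - 2 * out s (- s)"
      using s p(3)[OF s] by auto
    ultimately show "lam / 2 \<le> (\<Sum>v\<in>{-1, 1}. out s v * real_of_int (s * v))" using lam by simp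
  qed
  ultimately show thesis using that[OF is_algorithm_alg] by (simp add: mult.assoc mult.left_commute)
qed

section \<open>Choice of constants and assembly\<close>

lemma snr_facts:
  assumes lam: "lam = C * real d powr (-1/4)" "lam \<le> 1" and d: "0 < d" and C: "10 \<le> C"
  shows "0 < lam" "lam ^ 4 * real d = C ^ 4" "lam\<^sup>2 * sqrt (real d) = C\<^sup>2" "10000 \<le> real d"
proof -
  show l0: "0 < lam" using assms by simp
  have "(real d powr (-1/4)) ^ 4 = real d powr (- 1)" using d by (simp flip: powr_realpow add: powr_powr)
  then show l4: "lam ^ 4 * real d = C ^ 4" using d by (simp add: lam power_mult_distrib powr_minus)
  have "(lam\<^sup>2 * sqrt (real d))\<^sup>2 = (C\<^sup>2)\<^sup>2"
    using l4 by (simp add: power_mult_distrib flip: power_mult)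
  then show "lam\<^sup>2 * sqrt (real d) = C\<^sup>2" by (rule power2_eq_imp_eq) auto
  \<comment> \<open>The restriction lam \<le> 1 gives C^4 = lam^4 d \<le> d, so the dimension is
    automatically large.\<close>
  have "10 ^ 4 \<le> C ^ 4" using C by (intro power_mono) auto
  moreover have "lam ^ 4 * real d \<le> 1 * real d" using lam l0 by (intro mult_right_mono power_le_one) auto
  ultimately show "10000 \<le> real d" using l4 by simp
qed

theorem mainTheorem10:
  "\<exists>C0>0. \<forall>C\<ge>C0.
    \<comment> \<open>(1) one sample suffices for error 0.01\<close>
    (\<forall>d lam. lam = C * real d powr (-1/4) \<longrightarrow> 0 < d \<longrightarrow> lam \<le> 1 \<longrightarrow>
       (\<exists>M A. is_algorithm M A \<and> err_alg d lam 1 A \<le> 0.01))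
  \<and> \<comment> \<open>(2) memorization lower bound\<close>
    (\<exists>c>0. \<forall>d lam n \<alpha> M A. lam = C * real d powr (-1/4) \<longrightarrow> 0 < d \<longrightarrow> lam \<le> 1 \<longrightarrow> 1 \<le> n \<longrightarrow>
       0 < \<alpha> \<longrightarrow> \<alpha> < 1/2 \<longrightarrow> is_algorithm M A \<longrightarrow> err_alg d lam n A \<le> \<alpha> \<longrightarrow>
       (let L = ln (real d * real n * ln (real (card M)) / C_alpha \<alpha>) in
         mem d lam n M A \<ge> c * ((1 - 8 * lam^2 * real n * L) / (lam^4 * real n * L)) * C_alpha \<alpha>))
  \<and> \<comment> \<open>(2), in particular\<close>
    (\<forall>Ct>0. \<exists>c>0. \<exists>c'>0. \<exists>c''>0. \<exists>k::nat.
       \<forall>d lam n \<alpha> M A. lam = C * real d powr (-1/4) \<longrightarrow> 0 < d \<longrightarrow> lam \<le> 1 \<longrightarrow> 1 \<le> n \<longrightarrow>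
       0 < \<alpha> \<longrightarrow> \<alpha> < 1/2 \<longrightarrow> is_algorithm M A \<longrightarrow> err_alg d lam n A \<le> \<alpha> \<longrightarrow>
       real n \<le> c * sqrt (real d) / ln (real d * ln (real (card M)) / C_alpha \<alpha>) \<longrightarrow>
       real (card M) \<le> exp (real d powr Ct) \<longrightarrow>
       (let L = ln (real d * real n / C_alpha \<alpha>) in
         mem d lam n M A \<ge> c' * ((1 - 8 * lam^2 * real n * L) / (lam^4 * real n * L)) * C_alpha \<alpha>)
       \<and> (\<alpha> = 1/3 \<longrightarrow> mem d lam n M A \<ge> c'' * real d / (real n * (1 + ln (real d)) ^ k)))
  \<and> \<comment> \<open>(3) matching upper bounds\<close>
    (\<exists>K>0.
      (\<forall>d lam n. lam = C * real d powr (-1/4) \<longrightarrow> 0 < d \<longrightarrow> lam \<le> 1 \<longrightarrow> 1 \<le> n \<longrightarrow>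
         real n \<le> sqrt (real d) \<longrightarrow>
         (\<exists>M A. is_algorithm M A \<and> err_alg d lam n A \<le> 0.01 \<and>
                mem d lam n M A \<le> K * real d / real n))
    \<and> (\<forall>d lam n. lam = C * real d powr (-1/4) \<longrightarrow> 0 < d \<longrightarrow> lam \<le> 1 \<longrightarrow> 1 \<le> n \<longrightarrow>
         (\<exists>M A. is_algorithm M A \<and> err_alg d lam n A \<le> 0.01 \<and>
                mem d lam n M A \<le> K * (real d)^2 * real n * exp (- real n / sqrt (real d))))
    \<and> (\<forall>k>0. \<exists>K'>0. \<forall>d lam n. lam = C * real d powr (-1/4) \<longrightarrow> 0 < d \<longrightarrow> lam \<le> 1 \<longrightarrow> 1 \<le> n \<longrightarrow>
         K' * sqrt (real d) * ln (real d) \<le> real n \<longrightarrow>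
         (\<exists>M A. is_algorithm M A \<and> err_alg d lam n A \<le> 0.01 \<and>
                mem d lam n M A \<le> 1 / real d powr k)))"
proof (rule exI[of _ "10 :: real"], intro conjI allI impI)
  fix C :: real assume C: "10 \<le> C"
  \<comment> \<open>The threshold 10 makes the Chebyshev error 16 / C^4 smaller than 0.01, and C^2
    \<ge> 8 turns the rate lam^2 n / 8 into at least n / sqrt d.\<close>
  have C2: "100 \<le> C\<^sup>2" using power_mono[OF C, of 2] by simp
  have C4: "10000 \<le> C ^ 4" using power_mono[OF C, of 4] by simp
  have small: "16 / (lam ^ 4 * real d) \<le> 0.01" if "lam ^ 4 * real d = C ^ 4" for lam d
    using C4 unfolding that by (subst pos_divide_le_eq) auto
  have vote: "\<exists>M A. is_algorithm M A \<and> err_alg d lam n A \<le> 0.01 \<and> mem d lam n M A \<le> 2 * real d / real n"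
    if A: "lam = C * real d powr (-1/4)" "0 < d" "lam \<le> 1" "1 \<le> n" for d n lam
  proof -
    note F = snr_facts[OF A(1,3,2) C]
    obtain M A where "is_algorithm M A" "err_alg d lam n A \<le> 16 / (lam ^ 4 * real d)" "mem d lam n M A \<le> 2 * real d / real n"
      using random_vote_algorithm[OF A(2) F(1) A(3,4)] .
    then show ?thesis using small[OF F(2)] by fastforce
  qed
  have majority: "\<exists>M A. is_algorithm M A \<and> err_alg d lam n A \<le> 0.01 \<and> mem d lam n M A \<le> 2 * real d * exp (- real n / sqrt (real d))"
    if A: "lam = C * real d powr (-1/4)" "0 < d" "lam \<le> 1" and n: "sqrt (real d) \<le> real n" for d n lam
  proof -
    note F = snr_facts[OF A(1,3,2) C]
    have lam2: "lam\<^sup>2 = C\<^sup>2 / sqrt (real d)" using F(3) A(2) by (simp add: field_simps)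
    have r: "1 \<le> real n / sqrt (real d)" using n A(2) by simp
    have "8 * (real n / sqrt (real d)) \<le> C\<^sup>2 * (real n / sqrt (real d))" using C2 by (intro mult_right_mono) auto
    then have l: "real n / sqrt (real d) \<le> lam\<^sup>2 * real n / 8" "8 \<le> lam\<^sup>2 * real n" unfolding lam2 using r by auto
    obtain M A where M: "is_algorithm M A" "err_alg d lam n A \<le> 16 / (lam ^ 4 * real d)"
        "mem d lam n M A \<le> 2 * real d * exp (- (lam\<^sup>2 * real n / 8))"
      using majority_vote_algorithm[OF A(2) F(1) A(3) l(2)] .
    have "2 * real d * exp (- (lam\<^sup>2 * real n / 8)) \<le> 2 * real d * exp (- real n / sqrt (real d))"
      using l(1) by (intro mult_left_mono) auto
    then show ?thesis using M small[OF F(2)] by (meson order_trans)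
  qed
  show "\<exists>M A. is_algorithm M A \<and> err_alg d lam 1 A \<le> 0.01"
    if "lam = C * real d powr (-1/4)" "0 < d" "lam \<le> 1" for d lam
    using vote[OF that, of 1] by auto
  show "\<exists>c>0. \<forall>d lam n \<alpha> M A. lam = C * real d powr (-1/4) \<longrightarrow> 0 < d \<longrightarrow> lam \<le> 1 \<longrightarrow> 1 \<le> n \<longrightarrow>
       0 < \<alpha> \<longrightarrow> \<alpha> < 1/2 \<longrightarrow> is_algorithm M A \<longrightarrow> err_alg d lam n A \<le> \<alpha> \<longrightarrow>
       (let L = ln (real d * real n * ln (real (card M)) / C_alpha \<alpha>) in
         mem d lam n M A \<ge> c * ((1 - 8 * lam^2 * real n * L) / (lam^4 * real n * L)) * C_alpha \<alpha>)"
    unfolding Let_def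
  proof (intro exI[of _ "1/128 :: real"] conjI allI impI)
    fix d n :: nat and lam \<alpha> :: real and M A
    assume H: "lam = C * real d powr (-1/4)" "0 < d" "lam \<le> 1" "1 \<le> n" "0 < \<alpha>" "\<alpha> < 1/2"
      "is_algorithm M A" "err_alg d lam n A \<le> \<alpha>"
    note F = snr_facts[OF H(1,3,2) C]
    have "32 \<le> d" using F(4) by simp
    then show "1/128 * ((1 - 8 * lam\<^sup>2 * real n * ln (real d * real n * ln (real (card M)) / C_alpha \<alpha>))
       / (lam ^ 4 * real n * ln (real d * real n * ln (real (card M)) / C_alpha \<alpha>))) * C_alpha \<alpha> \<le> mem d lam n M A"
      by (intro mem_lower_bound_log[OF F(1) H(3-8)] log_factor_ge_2[OF F(1) H(3-6) _ H(7,8)])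
  qed simp
  show "\<exists>c>0. \<exists>c'>0. \<exists>c''>0. \<exists>k::nat.
       \<forall>d lam n \<alpha> M A. lam = C * real d powr (-1/4) \<longrightarrow> 0 < d \<longrightarrow> lam \<le> 1 \<longrightarrow> 1 \<le> n \<longrightarrow>
       0 < \<alpha> \<longrightarrow> \<alpha> < 1/2 \<longrightarrow> is_algorithm M A \<longrightarrow> err_alg d lam n A \<le> \<alpha> \<longrightarrow>
       real n \<le> c * sqrt (real d) / ln (real d * ln (real (card M)) / C_alpha \<alpha>) \<longrightarrow>
       real (card M) \<le> exp (real d powr Ct) \<longrightarrow>
       (let L = ln (real d * real n / C_alpha \<alpha>) in
         mem d lam n M A \<ge> c' * ((1 - 8 * lam^2 * real n * L) / (lam^4 * real n * L)) * C_alpha \<alpha>)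
       \<and> (\<alpha> = 1/3 \<longrightarrow> mem d lam n M A \<ge> c'' * real d / (real n * (1 + ln (real d)) ^ k))"
    if "0 < Ct" for Ct :: real
    unfolding Let_def
  \<comment> \<open>As lam^2 sqrt d = C^2, the first constant enforces lam^2 n \<le> 1/64. Then 1 -
    16 lam^2 n \<ge> 3/4, and lam^4 = C^4 / d gives the third constant. The exponent 0 reflects that
    no logarithm is lost.\<close>
  proof (rule exI[of _ "1 / (64 * C\<^sup>2)"], rule conjI, use C in simp,
      rule exI[of _ "1/128 :: real"], rule conjI, simp,
      rule exI[of _ "C_alpha (1/3) * (3/4) / (128 * C ^ 4)"], rule conjI,
      use C C_alpha_pos[of "1/3"] in simp, intro exI[of _ "0::nat"] conjI allI impI)
    fix d n :: nat and lam \<alpha> :: real and M A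
    assume H: "lam = C * real d powr (-1/4)" "0 < d" "lam \<le> 1" "1 \<le> n" "0 < \<alpha>" "\<alpha> < 1/2"
      "is_algorithm M A" "err_alg d lam n A \<le> \<alpha>"
      and nle: "real n \<le> 1 / (64 * C\<^sup>2) * sqrt (real d) / ln (real d * ln (real (card M)) / C_alpha \<alpha>)"
    note F = snr_facts[OF H(1,3,2) C]
    \<comment> \<open>The logarithm in the sample-size condition is at least 2, since C \<le> 4
      ln|M| and d is large; hence dividing by it only strengthens the condition.\<close>
    have x: "lam\<^sup>2 * real n \<le> 1/64"
    proof -
      have "C_alpha \<alpha> \<le> 4 * ln (real (card M))" using information_bounds[OF F(1) H(3-8)] by blast
      moreover have C0: "0 < C_alpha \<alpha>" using H by (intro C_alpha_pos)
      moreover have "32 * ln (real (card M)) \<le> real d * ln (real (card M))"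
        using calculation F(4) by (intro mult_right_mono) auto
      ultimately have "8 * C_alpha \<alpha> \<le> real d * ln (real (card M))" by linarith
      then have L: "2 \<le> ln (real d * ln (real (card M)) / C_alpha \<alpha>)"
        using C0 by (intro ln_ge_2) (simp add: pos_le_divide_eq)
      have "1 / (64 * C\<^sup>2) * sqrt (real d) / ln (real d * ln (real (card M)) / C_alpha \<alpha>) \<le> 1 / (64 * C\<^sup>2) * sqrt (real d) / 1"
        using L by (intro divide_left_mono) auto
      then have "real n \<le> sqrt (real d) / (64 * C\<^sup>2)" using nle by simp
      then have "lam\<^sup>2 * real n \<le> lam\<^sup>2 * (sqrt (real d) / (64 * C\<^sup>2))" by (intro mult_left_mono) auto
      also have "\<dots> = 1/64" using F(3) C by (simp add: field_simps)
      finally show ?thesis .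
    qed
    show "1/128 * ((1 - 8 * lam\<^sup>2 * real n * ln (real d * real n / C_alpha \<alpha>))
       / (lam ^ 4 * real n * ln (real d * real n / C_alpha \<alpha>))) * C_alpha \<alpha> \<le> mem d lam n M A"
      by (intro mem_lower_bound_log[OF F(1) H(3-8)] log_factor_small_sample_ge_2[OF F(1) H(3,4) x H(5-8)])
    assume \<alpha>: "\<alpha> = 1/3"
    have ln0: "0 < lam ^ 4 * real n" using F(1) H(4) by simp
    have "C_alpha (1/3) * (3/4) / (128 * C ^ 4) * real d / (real n * (1 + ln (real d)) ^ 0)
       = C_alpha (1/3) * (3/4) / (128 * (lam ^ 4 * real n))"
      unfolding F(2)[symmetric] using F(1) H(2,4) by (simp add: field_simps)
    also have "\<dots> \<le> C_alpha (1/3) * (1 - 16 * (lam\<^sup>2 * real n)) / (128 * (lam ^ 4 * real n))"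
      using x ln0 C_alpha_pos[of "1/3"] by (intro divide_right_mono mult_left_mono) auto
    also have "\<dots> \<le> mem d lam n M A"
      using mem_lower_bound[OF F(1) H(4) _ H(5-8)] x unfolding \<alpha> by simp
    finally show "C_alpha (1/3) * (3/4) / (128 * C ^ 4) * real d / (real n * (1 + ln (real d)) ^ 0) \<le> mem d lam n M A" .
  qed
  show "\<exists>K>0.
      (\<forall>d lam n. lam = C * real d powr (-1/4) \<longrightarrow> 0 < d \<longrightarrow> lam \<le> 1 \<longrightarrow> 1 \<le> n \<longrightarrow>
         real n \<le> sqrt (real d) \<longrightarrow>
         (\<exists>M A. is_algorithm M A \<and> err_alg d lam n A \<le> 0.01 \<and>
                mem d lam n M A \<le> K * real d / real n))
    \<and> (\<forall>d lam n. lam = C * real d powr (-1/4) \<longrightarrow> 0 < d \<longrightarrow> lam \<le> 1 \<longrightarrow> 1 \<le> n \<longrightarrow>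
         (\<exists>M A. is_algorithm M A \<and> err_alg d lam n A \<le> 0.01 \<and>
                mem d lam n M A \<le> K * (real d)^2 * real n * exp (- real n / sqrt (real d))))
    \<and> (\<forall>k>0. \<exists>K'>0. \<forall>d lam n. lam = C * real d powr (-1/4) \<longrightarrow> 0 < d \<longrightarrow> lam \<le> 1 \<longrightarrow> 1 \<le> n \<longrightarrow>
         K' * sqrt (real d) * ln (real d) \<le> real n \<longrightarrow>
         (\<exists>M A. is_algorithm M A \<and> err_alg d lam n A \<le> 0.01 \<and>
                mem d lam n M A \<le> 1 / real d powr k))"
  \<comment> \<open>The constant is the 2 of both votes times 3, an upper bound for e needed when n
    < sqrt d.\<close>
  proof (rule exI[of _ "6 :: real"], intro conjI allI impI)
    fix d n :: nat and lam :: real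
    assume H: "lam = C * real d powr (-1/4)" "0 < d" "lam \<le> 1" "1 \<le> n"
    note F = snr_facts[OF H(1,3,2) C]
    obtain M A where M: "is_algorithm M A" "err_alg d lam n A \<le> 0.01" "mem d lam n M A \<le> 2 * real d / real n"
      using vote[OF H] by blast
    have le6: "2 * real d / real n \<le> 6 * real d / real n" by (intro divide_right_mono) auto
    then show "\<exists>M A. is_algorithm M A \<and> err_alg d lam n A \<le> 0.01 \<and> mem d lam n M A \<le> 6 * real d / real n"
      using M by (meson order_trans)
    have ddn: "real d \<le> (real d)\<^sup>2 * real n"
    proof -
      have "real d * 1 \<le> real d * (real d * real n)" using H(2,4)
        by (intro mult_left_mono) (auto simp flip: of_nat_mult)
      then show ?thesis by (simp add: power2_eq_square mult.assoc)
    qed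
    show "\<exists>M A. is_algorithm M A \<and> err_alg d lam n A \<le> 0.01 \<and>
                mem d lam n M A \<le> 6 * (real d)^2 * real n * exp (- real n / sqrt (real d))"
    \<comment> \<open>Below sqrt d the random vote suffices, because there the exponential factor is
      at least 1/e.\<close>
    proof (cases "sqrt (real d) \<le> real n")
      case True
      obtain M A where M: "is_algorithm M A" "err_alg d lam n A \<le> 0.01" "mem d lam n M A \<le> 2 * real d * exp (- real n / sqrt (real d))"
        using majority[OF H(1-3) True] by blast
      have "2 * real d * exp (- real n / sqrt (real d)) \<le> 6 * (real d)^2 * real n * exp (- real n / sqrt (real d))"
      proof (rule mult_right_mono)
        show "2 * real d \<le> 6 * (real d)\<^sup>2 * real n" using ddn by linarith
      qed simp
      then show ?thesis using M by (meson order_trans)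
    next
      case False
      then have "real n / sqrt (real d) \<le> 1" using H(2) by simp
      then have "exp (- 1) \<le> exp (- real n / sqrt (real d))" by simp
      moreover have "1/3 \<le> exp (- 1 :: real)" using e_less_272 by (simp add: exp_minus field_simps)
      ultimately have e: "1/3 \<le> exp (- real n / sqrt (real d))" by linarith
      have "2 * real d / real n \<le> 2 * real d / 1" using H(4) by (intro divide_left_mono) auto
      also have "\<dots> = 2 * real d" by simp
      also have "\<dots> \<le> 6 * (real d)\<^sup>2 * real n * (1/3)" using ddn by linarith
      also have "\<dots> \<le> 6 * (real d)\<^sup>2 * real n * exp (- real n / sqrt (real d))" using e by (intro mult_left_mono) auto
      finally show ?thesis using M by (meson order_trans)
    qed
  next
    fix k :: real assume k: "0 < k"
    show "\<exists>K'>0. \<forall>d lam n. lam = C * real d powr (-1/4) \<longrightarrow> 0 < d \<longrightarrow> lam \<le> 1 \<longrightarrow> 1 \<le> n \<longrightarrow>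
         K' * sqrt (real d) * ln (real d) \<le> real n \<longrightarrow>
         (\<exists>M A. is_algorithm M A \<and> err_alg d lam n A \<le> 0.01 \<and> mem d lam n M A \<le> 1 / real d powr k)"
    \<comment> \<open>Of the two extra powers of \<open>d\<close>, one cancels the prefactor
      \<open>d\<close> and the other absorbs the constant 2.\<close>
    proof (intro exI[of _ "k + 2"] conjI allI impI)
      fix d n :: nat and lam :: real
      assume H: "lam = C * real d powr (-1/4)" "0 < d" "lam \<le> 1" "1 \<le> n"
        and n: "(k + 2) * sqrt (real d) * ln (real d) \<le> real n"
      note F = snr_facts[OF H(1,3,2) C]
      have lnd: "2 \<le> ln (real d)" using F(4) by (intro ln_ge_2) auto
      have sd: "0 < sqrt (real d)" using H(2) by simp
      have kl: "1 * 1 \<le> (k + 2) * ln (real d)" using k lnd by (intro mult_mono) auto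
      have "sqrt (real d) * 1 \<le> sqrt (real d) * ((k + 2) * ln (real d))" using kl sd by (intro mult_left_mono) auto
      then have "sqrt (real d) \<le> real n" using n by (simp add: algebra_simps)
      then obtain M A where M: "is_algorithm M A" "err_alg d lam n A \<le> 0.01" "mem d lam n M A \<le> 2 * real d * exp (- real n / sqrt (real d))"
        using majority[OF H(1-3)] by blast
      have "(k + 2) * ln (real d) \<le> real n / sqrt (real d)" using n sd by (simp add: pos_le_divide_eq algebra_simps)
      then have "exp (- real n / sqrt (real d)) \<le> exp (- ((k + 2) * ln (real d)))" by simp
      also have "\<dots> = real d powr (- (k + 2))" using H(2) by (simp add: powr_def algebra_simps)
      finally have "2 * real d * exp (- real n / sqrt (real d)) \<le> 2 * real d * real d powr (- (k + 2))"
        by (intro mult_left_mono) auto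
      also have "\<dots> \<le> (real d * real d) * real d powr (- (k + 2))"
        using F(4) by (intro mult_right_mono) auto
      also have "real d * real d = real d powr 2" using H(2) by (simp add: powr_numeral power2_eq_square)
      also have "real d powr 2 * real d powr (- (k + 2)) = 1 / real d powr k"
        by (simp only: powr_add[symmetric]) (simp add: powr_minus divide_inverse)
      finally show "\<exists>M A. is_algorithm M A \<and> err_alg d lam n A \<le> 0.01 \<and> mem d lam n M A \<le> 1 / real d powr k"
        using M by (meson order_trans)
    qed (use k in simp)
  qed simp
qed simp

end
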